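(* Let $\Gamma\subset\mathbb{CP}^2$ be a non-degenerate binodal quartic curve with nodes $T_1$ and $T_2$, let $\hat\Gamma$ be its elliptic normalization, and let $P\in\Gamma\setminus\{T_1,T_2\}$. Let $\mathcal{C}_P$ be the two-dimensional family of all conics (degenerate conics included) passing through the three points $T_1,T_2,P$. Every conic $c\in\mathcal{C}_P$ intersects $\Gamma$ at three additional points $X_c,Y_c,Z_c\in\hat\Gamma$ (which need not be distinct and which may lie over $T_1$, $T_2$ or $P$). Then one can choose a neutral element $N_P\in\hat\Gamma$ for the addition law on $\hat\Gamma$ such that, for the resulting group law, $X_c+Y_c+Z_c=0$ for every $c\in\mathcal{C}_P$.
   Context: A node of a complex plane curve is a singular point at which two regular local branches intersect transversally. A quartic curve in $\mathbb{CP}^2$ is called binodal if it has two nodes, and non-degenerate binodal if moreover it has no other singularities. The normalization $\hat\Gamma$ of a non-degenerate binodal quartic $\Gamma$ is an elliptic curve, with a holomorphic map $\pi:\hat\Gamma\to\Gamma$ that is bijective outside the nodes; each node has two preimages. Once a neutral element in $\hat\Gamma$ is chosen, $\hat\Gamma$ has a unique structure of elliptic curve group with that neutral element. Points of $\Gamma$ other than the nodes are identified with their preimages in $\hat\Gamma$. The additional intersection points are understood with multiplicity on $\hat\Gamma$: the pullback to $\hat\Gamma$ of the equation of a conic $c\in\mathcal{C}_P$ defines an effective divisor of degree $8$ which contains the four points of $\pi^{-1}(\{T_1,T_2\})$ and the point $P$ (each at least once); subtracting these five points (each once) leaves the effective degree-$3$ divisor $[X_c]+[Y_c]+[Z_c]$.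 *)

theory Defs
  imports
    "HOL-Complex_Analysis.Complex_Analysis"
    "HOL-Algebra.Coset"
    "HOL-Library.Multiset"
begin

subsection \<open>Plane projective curves\<close>

text \<open>A point of the projective plane is a one-dimensional linear subspace of
  the three-dimensional complex vector space.\<close>

definition proj_pt :: "complex ^ 3 \<Rightarrow> (complex ^ 3) set" where
  "proj_pt v = vec.span {v}"

definition CP2 :: "(complex ^ 3) set set" where
  "CP2 = proj_pt ` (- {0})"

text \<open>Homogeneous polynomials in three variables are identified with the functions they
  induce, which is harmless over an infinite field.\<close>

definition ternary_form :: "nat \<Rightarrow> (complex ^ 3 \<Rightarrow> complex) \<Rightarrow> bool" where
  "ternary_form d F \<longleftrightarrow> (\<exists>a :: nat \<Rightarrow> nat \<Rightarrow> complex. \<forall>v.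
     F v = (\<Sum>i\<le>d. \<Sum>j\<le>d - i. a i j * (v $ 1) ^ i * (v $ 2) ^ j * (v $ 3) ^ (d - i - j)))"

definition plane_curve :: "(complex ^ 3 \<Rightarrow> complex) \<Rightarrow> (complex ^ 3) set set" where
  "plane_curve F = {L \<in> CP2. \<forall>v\<in>L. F v = 0}"

text \<open>The complex gradient of \<open>f\<close> at \<open>v\<close>. The derivative is taken over the reals, but the
  displayed linear map is complex linear, so this is complex differentiability.\<close>

definition has_gradient :: "(complex ^ 3 \<Rightarrow> complex) \<Rightarrow> complex ^ 3 \<Rightarrow> complex ^ 3 \<Rightarrow> bool" where
  "has_gradient f a v \<longleftrightarrow> (f has_derivative (\<lambda>h. \<Sum>i\<in>UNIV. a $ i * h $ i)) (at v)"

definition holomorphic3_on :: "(complex ^ 3 \<Rightarrow> complex) \<Rightarrow> (complex ^ 3) set \<Rightarrow> bool" where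
  "holomorphic3_on f U \<longleftrightarrow> open U \<and> (\<forall>v\<in>U. \<exists>a. has_gradient f a v)"

definition singular_points :: "(complex ^ 3 \<Rightarrow> complex) \<Rightarrow> (complex ^ 3) set set" where
  "singular_points F = {L \<in> plane_curve F. \<forall>v\<in>L - {0}. has_gradient F 0 v}"

text \<open>Two regular local branches meeting transversally: near a representative \<open>v\<close> of the
  point, \<open>F\<close> factors as a product \<open>f g\<close> of holomorphic functions, and the germs \<open>f = 0\<close> and
  \<open>g = 0\<close> are smooth with distinct tangent spaces. This is stated on the affine cone over the
  curve. Since \<open>F\<close> is homogeneous, both germs contain the line through \<open>v\<close>, so that their
  gradients annihilate \<open>v\<close>, and independence of the gradients is transversality of the two
  branches in the projective plane.\<close>

definition is_node :: "(complex ^ 3 \<Rightarrow> complex) \<Rightarrow> (complex ^ 3) set \<Rightarrow> bool" where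
  "is_node F L \<longleftrightarrow> L \<in> singular_points F \<and>
     (\<exists>v\<in>L - {0}. \<exists>U f g a b.
        v \<in> U \<and> holomorphic3_on f U \<and> holomorphic3_on g U \<and> (\<forall>w\<in>U. F w = f w * g w) \<and>
        f v = 0 \<and> g v = 0 \<and> has_gradient f a v \<and> has_gradient g b v \<and>
        a \<noteq> b \<and> vec.independent {a, b})"

definition nondegenerate_binodal_quartic ::
    "(complex ^ 3 \<Rightarrow> complex) \<Rightarrow> (complex ^ 3) set \<Rightarrow> (complex ^ 3) set \<Rightarrow> bool" where
  "nondegenerate_binodal_quartic F T1 T2 \<longleftrightarrow>
     ternary_form 4 F \<and> (\<exists>v. F v \<noteq> 0) \<and>
     T1 \<noteq> T2 \<and> is_node F T1 \<and> is_node F T2 \<and> singular_points F = {T1, T2}"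

text \<open>All conics, degenerate ones included, through the points of \<open>S\<close>, each given by an equation.\<close>

definition conics_through :: "(complex ^ 3) set set \<Rightarrow> (complex ^ 3 \<Rightarrow> complex) set" where
  "conics_through S = {c. ternary_form 2 c \<and> (\<exists>v. c v \<noteq> 0) \<and> S \<subseteq> plane_curve c}"


subsection \<open>Elliptic curves\<close>

definition complex_lattice :: "complex set \<Rightarrow> bool" where
  "complex_lattice \<Lambda> \<longleftrightarrow> (\<exists>\<omega>\<^sub>1 \<omega>\<^sub>2. Im (\<omega>\<^sub>2 / \<omega>\<^sub>1) \<noteq> 0 \<and>
     \<Lambda> = {of_int m * \<omega>\<^sub>1 + of_int n * \<omega>\<^sub>2 | m n. True})"

definition complex_add_group :: "complex monoid" where
  "complex_add_group = \<lparr>carrier = UNIV, mult = (+), one = 0\<rparr>"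

definition torus :: "complex set \<Rightarrow> complex set monoid" where
  "torus \<Lambda> = complex_add_group Mod \<Lambda>"

definition torus_pt :: "complex set \<Rightarrow> complex \<Rightarrow> complex set" where
  "torus_pt \<Lambda> z = \<Lambda> #>\<^bsub>complex_add_group\<^esub> z"

text \<open>The elliptic curve group structure whose neutral element is \<open>N\<close>: the quotient group
  structure transported by the biholomorphic translation taking its neutral element to \<open>N\<close>.\<close>

definition elliptic_group :: "complex set \<Rightarrow> complex set \<Rightarrow> complex set monoid" where
  "elliptic_group \<Lambda> N =
     \<lparr>carrier = carrier (torus \<Lambda>),
      mult = (\<lambda>x y. x \<otimes>\<^bsub>torus \<Lambda>\<^esub> y \<otimes>\<^bsub>torus \<Lambda>\<^esub> inv\<^bsub>torus \<Lambda>\<^esub> N),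
      one = N\<rparr>"

lemma comm_group_torus:
  assumes "complex_lattice \<Lambda>"
  shows "comm_group (torus \<Lambda>)"
proof -
  obtain \<omega>\<^sub>1 \<omega>\<^sub>2 where \<Lambda>: "\<Lambda> = {of_int m * \<omega>\<^sub>1 + of_int n * \<omega>\<^sub>2 | m n. True}"
    using assms unfolding complex_lattice_def by blast
  have G: "comm_group complex_add_group"
    unfolding complex_add_group_def
    by (rule comm_groupI) (auto simp: algebra_simps intro: exI[of _ "- x" for x])
  interpret G: comm_group complex_add_group by (rule G)
  have inv: "inv\<^bsub>complex_add_group\<^esub> x = - x" for x
    by (rule G.inv_equality) (auto simp: complex_add_group_def)
  have "subgroup \<Lambda> complex_add_group"
  proof (rule G.subgroupI)
    show "\<Lambda> \<noteq> {}" unfolding \<Lambda> by blast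
  next
    fix x assume "x \<in> \<Lambda>"
    then obtain m n where "x = of_int m * \<omega>\<^sub>1 + of_int n * \<omega>\<^sub>2" unfolding \<Lambda> by blast
    then have "- x = of_int (- m) * \<omega>\<^sub>1 + of_int (- n) * \<omega>\<^sub>2" by simp
    then show "inv\<^bsub>complex_add_group\<^esub> x \<in> \<Lambda>" unfolding inv \<Lambda> by blast
  next
    fix x y assume "x \<in> \<Lambda>" "y \<in> \<Lambda>"
    then obtain m n m' n' where
      "x = of_int m * \<omega>\<^sub>1 + of_int n * \<omega>\<^sub>2" "y = of_int m' * \<omega>\<^sub>1 + of_int n' * \<omega>\<^sub>2"
      unfolding \<Lambda> by blast
    then have "x + y = of_int (m + m') * \<omega>\<^sub>1 + of_int (n + n') * \<omega>\<^sub>2"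
      by (simp add: algebra_simps)
    then have "x + y \<in> \<Lambda>" unfolding \<Lambda> by blast
    then show "x \<otimes>\<^bsub>complex_add_group\<^esub> y \<in> \<Lambda>" by (simp add: complex_add_group_def)
  qed (simp add: complex_add_group_def)
  then show ?thesis
    unfolding torus_def by (rule G.abelian_FactGroup)
qed

lemma comm_group_elliptic_group:
  assumes "complex_lattice \<Lambda>" and N: "N \<in> carrier (torus \<Lambda>)"
  shows "comm_group (elliptic_group \<Lambda> N)"
    and "(\<lambda>x. x \<otimes>\<^bsub>torus \<Lambda>\<^esub> N) \<in> iso (torus \<Lambda>) (elliptic_group \<Lambda> N)"
proof -
  interpret T: comm_group "torus \<Lambda>" by (rule comm_group_torus) fact
  show "comm_group (elliptic_group \<Lambda> N)"
  proof (rule comm_groupI)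
    fix x assume "x \<in> carrier (elliptic_group \<Lambda> N)"
    then show "\<exists>y\<in>carrier (elliptic_group \<Lambda> N).
        y \<otimes>\<^bsub>elliptic_group \<Lambda> N\<^esub> x = \<one>\<^bsub>elliptic_group \<Lambda> N\<^esub>"
      using N by (intro bexI[of _ "inv\<^bsub>torus \<Lambda>\<^esub> x \<otimes>\<^bsub>torus \<Lambda>\<^esub> (N \<otimes>\<^bsub>torus \<Lambda>\<^esub> N)"])
        (auto simp: elliptic_group_def T.m_ac T.r_inv_ex T.inv_solve_right')
  qed (use N in \<open>auto simp: elliptic_group_def T.m_ac\<close>)
  have "inj_on (\<lambda>x. x \<otimes>\<^bsub>torus \<Lambda>\<^esub> N) (carrier (torus \<Lambda>))"
    using N by (auto intro: inj_onI)
  moreover have "y \<in> (\<lambda>x. x \<otimes>\<^bsub>torus \<Lambda>\<^esub> N) ` carrier (torus \<Lambda>)"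
    if "y \<in> carrier (torus \<Lambda>)" for y
    using N that by (intro image_eqI[of _ _ "y \<otimes>\<^bsub>torus \<Lambda>\<^esub> inv\<^bsub>torus \<Lambda>\<^esub> N"]) (auto simp: T.m_assoc)
  ultimately show "(\<lambda>x. x \<otimes>\<^bsub>torus \<Lambda>\<^esub> N) \<in> iso (torus \<Lambda>) (elliptic_group \<Lambda> N)"
    using N by (auto simp: iso_def hom_def bij_betw_def elliptic_group_def T.m_ac)
qed


subsection \<open>Normalization and intersection with conics\<close>

text \<open>\<open>\<phi>\<close> expresses \<open>\<pi>\<close> near \<open>z\<close> in holomorphic homogeneous coordinates without common zeros.\<close>

definition local_lift ::
    "complex set \<Rightarrow> (complex set \<Rightarrow> (complex ^ 3) set) \<Rightarrow> complex \<Rightarrow> (complex \<Rightarrow> complex ^ 3) \<Rightarrow> bool" where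
  "local_lift \<Lambda> \<pi> z \<phi> \<longleftrightarrow> (\<exists>r>0. (\<forall>i. (\<lambda>w. \<phi> w $ i) holomorphic_on ball z r) \<and>
     (\<forall>w\<in>ball z r. \<phi> w \<noteq> 0 \<and> \<pi> (torus_pt \<Lambda> w) = proj_pt (\<phi> w)))"

definition holomorphic_to_CP2 :: "complex set \<Rightarrow> (complex set \<Rightarrow> (complex ^ 3) set) \<Rightarrow> bool" where
  "holomorphic_to_CP2 \<Lambda> \<pi> \<longleftrightarrow> (\<forall>z. \<exists>\<phi>. local_lift \<Lambda> \<pi> z \<phi>)"

definition elliptic_normalization ::
    "complex set \<Rightarrow> (complex set \<Rightarrow> (complex ^ 3) set) \<Rightarrow> (complex ^ 3 \<Rightarrow> complex) \<Rightarrow>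
     (complex ^ 3) set \<Rightarrow> (complex ^ 3) set \<Rightarrow> bool" where
  "elliptic_normalization \<Lambda> \<pi> F T1 T2 \<longleftrightarrow>
     complex_lattice \<Lambda> \<and> holomorphic_to_CP2 \<Lambda> \<pi> \<and>
     \<pi> ` carrier (torus \<Lambda>) = plane_curve F \<and>
     bij_betw \<pi> {x \<in> carrier (torus \<Lambda>). \<pi> x \<notin> {T1, T2}} (plane_curve F - {T1, T2}) \<and>
     (\<forall>T\<in>{T1, T2}. card {x \<in> carrier (torus \<Lambda>). \<pi> x = T} = 2)"

text \<open>The multiplicity at \<open>x\<close> of the pullback of the equation \<open>c\<close>. It depends neither on the
  representative \<open>z\<close> of \<open>x\<close> nor on the lift.\<close>

definition pullback_order ::
    "complex set \<Rightarrow> (complex set \<Rightarrow> (complex ^ 3) set) \<Rightarrow> (complex ^ 3 \<Rightarrow> complex) \<Rightarrow> complex set \<Rightarrow> int" where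
  "pullback_order \<Lambda> \<pi> c x =
     (THE n. \<exists>z\<in>x. \<exists>\<phi>. local_lift \<Lambda> \<pi> z \<phi> \<and> n = zorder (\<lambda>w. c (\<phi> w)) z)"

text \<open>The pullback divisor of \<open>c\<close> is the sum of the points over \<open>S\<close>, each taken once, and of
  \<open>X\<close>, \<open>Y\<close>, \<open>Z\<close>. For \<open>S = {T1, T2, P}\<close> there are five points over \<open>S\<close>.\<close>

definition additional_points ::
    "complex set \<Rightarrow> (complex set \<Rightarrow> (complex ^ 3) set) \<Rightarrow> (complex ^ 3) set set \<Rightarrow>
     (complex ^ 3 \<Rightarrow> complex) \<Rightarrow> complex set \<Rightarrow> complex set \<Rightarrow> complex set \<Rightarrow> bool" where
  "additional_points \<Lambda> \<pi> S c X Y Z \<longleftrightarrow>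
     {X, Y, Z} \<subseteq> carrier (torus \<Lambda>) \<and>
     (\<forall>x\<in>carrier (torus \<Lambda>). pullback_order \<Lambda> \<pi> c x =
        int (count (mset_set {y \<in> carrier (torus \<Lambda>). \<pi> y \<in> S} + {#X, Y, Z#}) x))"

end

theory Submission
  imports Defs "HOL-Computational_Algebra.Fundamental_Theorem_Algebra"
begin

text \<open>Project the curve from a point \<open>q = (\<alpha>, \<beta>, 1)\<close> off it. In the chart \<open>s = 1\<close> for a line \<open>s = 0\<close> through \<open>q\<close>,
  the normalization becomes an elliptic map \<open>\<psi>\<close>, and for a form \<open>c\<close> of degree \<open>d\<close> the divisor of the
  elliptic function \<open>c \<circ> \<psi>\<close> is the pullback divisor of \<open>c\<close> minus \<open>d\<close> times that of \<open>s\<close>. By the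
  argument principle over a period parallelogram it has degree \<open>0\<close> and sum in the lattice
  (the easy half of Abel's theorem). Hence the pullback divisors of all conics have the same
  degree and the same sum, and after removing the five fixed points \<open>X + Y + Z\<close> is
  constant; \<open>N\<close> is a third of this constant. The degree is \<open>8\<close> because a
  generic line through \<open>q\<close> meets the quartic in four distinct smooth points, where the elliptic
  function \<open>t / s\<close> with \<open>t\<close> a second line through \<open>q\<close> is unramified.\<close>

text \<open>The power series notation makes every vector component ambiguous.\<close>

no_notation fps_nth (infixl "$" 75)

subsection \<open>Divisors of elliptic functions\<close>

text \<open>Homogeneous coordinates exist on the torus only through local lifts, so a form is not a
  function there and its zeros cannot be counted by a contour integral directly. Dividing by a power
  of one fixed linear form repairs this. The price is the divisor of that linear form, which enters
  every conic with the same factor 2 and drops out of the comparison. Placing the center off the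
  curve serves two ends: \<open>s\<close> and \<open>t\<close> have no common zero on the curve, and
  \<open>F\<close> restricted to a line through the center has degree exactly 4. The degree is
  needed because the three additional points must be shown to exist: of 2 * 4 = 8 points, two over
  each node and one over \<open>P\<close> are removed. That a conic cannot contain the curve comes
  from counting as well: a form vanishes on the curve either identically or only on a sparse set
  (identity theorem on the plane covering the torus), and four points on a generic line are too many
  for a polynomial of degree 2.\<close>

lemma contour_integral_logderiv_periodic:
  fixes f :: "complex \<Rightarrow> complex"
  assumes "f analytic_on path_image g" "valid_path g" "\<And>z. z \<in> path_image g \<Longrightarrow> f z \<noteq> 0"
    and "f (pathfinish g) = f (pathstart g)"
  obtains k :: int where "contour_integral g (\<lambda>z. deriv f z / f z) = 2 * pi * \<i> * of_int k"
proof -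
  have vp: "valid_path (f \<circ> g)"
    using assms(1,2) by (intro valid_path_compose_analytic) auto
  have nz: "0 \<notin> path_image (f \<circ> g)"
    using assms(3) by (auto simp: path_image_compose)
  have "contour_integral g (\<lambda>z. deriv f z / f z) = contour_integral (f \<circ> g) (\<lambda>w. 1 / (w - 0))"
    using assms by (subst contour_integral_comp_analyticW[of _ "path_image g"]) auto
  also have "\<dots> = 2 * pi * \<i> * winding_number (f \<circ> g) 0"
    using winding_number_valid_path[OF vp nz] by (simp add: field_simps)
  finally have *: "contour_integral g (\<lambda>z. deriv f z / f z) = 2 * pi * \<i> * winding_number (f \<circ> g) 0" .
  \<comment> \<open>Equal end values make the image of \<open>g\<close> under \<open>f\<close> a
    closed path, although \<open>g\<close> itself need not be closed.\<close>
  have "winding_number (f \<circ> g) 0 \<in> \<int>"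
    using vp nz assms(4)
    by (intro integer_winding_number valid_path_imp_path) (auto simp: pathfinish_compose pathstart_compose)
  with * that show ?thesis
    by (auto elim!: Ints_cases)
qed

lemma contour_integral_linepath_shift:
  "contour_integral (linepath (a + w) (b + w)) f = contour_integral (linepath a b) (\<lambda>z. f (z + w))"
proof -
  have "linepath (a + w) (b + w) = (+) w \<circ> linepath a b"
    by (auto simp: linepath_def fun_eq_iff algebra_simps)
  then show ?thesis by (simp only: contour_integral_translate)
qed

lemma finite_zeros_bounded:
  fixes A :: "complex set"
  assumes "eventually (\<lambda>z. P z) (cosparse UNIV)" "bounded A"
  shows "finite {z \<in> A. \<not> P z}"
proof -
  have "finite (closure A \<inter> {z. \<not> P z})"
  proof (rule sparse_in_compact_finite)
    have "{z. \<not> P z} sparse_in (UNIV :: complex set)"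
      using assms(1) by (simp add: eventually_cosparse)
    then show "{z. \<not> P z} sparse_in closure A"
      by (rule sparse_in_subset) simp
  qed (use assms in simp)
  moreover have "{z \<in> A. \<not> P z} \<subseteq> closure A \<inter> {z. \<not> P z}"
    using closure_subset by blast
  ultimately show ?thesis by (rule finite_subset[rotated])
qed

section \<open>Lattice coordinates and period parallelograms\<close>

locale period_lattice =
  fixes \<omega>1 \<omega>2 :: complex
  assumes nondegenerate: "Im (\<omega>2 / \<omega>1) \<noteq> 0"
begin

definition lattice :: "complex set" where
  "lattice = {of_int m * \<omega>1 + of_int n * \<omega>2 | m n. True}"

text \<open>Division by \<open>\<omega>1\<close> turns the real basis into 1 and
  \<open>\<omega>2 / \<omega>1\<close>. The imaginary part then fixes the coefficient of
  \<open>\<omega>2\<close>, and the real part that of \<open>\<omega>1\<close>.\<close>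

definition ycoord :: "complex \<Rightarrow> real" where
  "ycoord z = Im (z / \<omega>1) / Im (\<omega>2 / \<omega>1)"

definition xcoord :: "complex \<Rightarrow> real" where
  "xcoord z = Re (z / \<omega>1) - ycoord z * Re (\<omega>2 / \<omega>1)"

lemma omega1_nonzero: "\<omega>1 \<noteq> 0"
  using nondegenerate by auto

lemma coord_eq: "z = of_real (xcoord z) * \<omega>1 + of_real (ycoord z) * \<omega>2"
proof -
  have "A = of_real (Re A - Im A / Im t * Re t) + of_real (Im A / Im t) * t" if "Im t \<noteq> 0" for A t
    using that by (simp add: complex_eq_iff)
  from this[OF nondegenerate] have "z / \<omega>1 = of_real (xcoord z) + of_real (ycoord z) * (\<omega>2 / \<omega>1)"
    unfolding xcoord_def ycoord_def .
  then show ?thesis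
    using omega1_nonzero by (simp add: field_simps)
qed

lemma ycoord_add: "ycoord (z + w) = ycoord z + ycoord w"
  and ycoord_diff: "ycoord (z - w) = ycoord z - ycoord w"
  and ycoord_scale: "ycoord (of_real r * z) = r * ycoord z"
  by (simp_all add: ycoord_def add_divide_distrib diff_divide_distrib flip: times_divide_eq_right)

lemma xcoord_add: "xcoord (z + w) = xcoord z + xcoord w"
  and xcoord_diff: "xcoord (z - w) = xcoord z - xcoord w"
  and xcoord_scale: "xcoord (of_real r * z) = r * xcoord z"
proof -
  have "Re (of_real r * z / \<omega>1) = r * Re (z / \<omega>1)"
    by (simp flip: times_divide_eq_right)
  then show "xcoord (of_real r * z) = r * xcoord z"
    unfolding xcoord_def ycoord_scale by (simp only: right_diff_distrib mult.assoc)
qed (simp_all add: xcoord_def ycoord_add ycoord_diff algebra_simps add_divide_distrib diff_divide_distrib)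

lemma coord_omega: "xcoord \<omega>1 = 1" "ycoord \<omega>1 = 0" "xcoord \<omega>2 = 0" "ycoord \<omega>2 = 1"
  using omega1_nonzero nondegenerate by (simp_all add: xcoord_def ycoord_def)

lemmas coord_simps = xcoord_add xcoord_diff xcoord_scale ycoord_add ycoord_diff ycoord_scale coord_omega

lemma coord_scale_int: "xcoord (of_int m * z) = m * xcoord z" "ycoord (of_int m * z) = m * ycoord z"
  using xcoord_scale[of m z] ycoord_scale[of m z] by simp_all

lemma coord_scaleR: "xcoord (r *\<^sub>R z) = r * xcoord z" "ycoord (r *\<^sub>R z) = r * ycoord z"
  by (simp_all add: scaleR_conv_of_real coord_simps)

lemma coord_inject: "xcoord z = xcoord w \<Longrightarrow> ycoord z = ycoord w \<Longrightarrow> z = w"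
  by (metis coord_eq)

lemma lattice_iff: "z \<in> lattice \<longleftrightarrow> xcoord z \<in> \<int> \<and> ycoord z \<in> \<int>"
proof
  assume "z \<in> lattice"
  then obtain m n where "z = of_int m * \<omega>1 + of_int n * \<omega>2" unfolding lattice_def by blast
  then have "xcoord z = m" "ycoord z = n" by (simp_all add: coord_simps coord_scale_int)
  then show "xcoord z \<in> \<int> \<and> ycoord z \<in> \<int>" by simp
next
  assume "xcoord z \<in> \<int> \<and> ycoord z \<in> \<int>"
  then obtain m n where "xcoord z = of_int m" "ycoord z = of_int n" by (auto elim!: Ints_cases)
  then have "z = of_int m * \<omega>1 + of_int n * \<omega>2" using coord_eq[of z] by simp
  then show "z \<in> lattice" unfolding lattice_def by blast
qed

lemma lattice_add: "z \<in> lattice \<Longrightarrow> w \<in> lattice \<Longrightarrow> z + w \<in> lattice"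
  and lattice_diff: "z \<in> lattice \<Longrightarrow> w \<in> lattice \<Longrightarrow> z - w \<in> lattice"
  and lattice_of_int: "z \<in> lattice \<Longrightarrow> of_int k * z \<in> lattice"
  and lattice_0: "0 \<in> lattice"
  and lattice_uminus: "z \<in> lattice \<Longrightarrow> - z \<in> lattice"
  using coord_scale_int(1)[of 0 0] coord_scale_int(2)[of 0 0] xcoord_diff[of 0 z] ycoord_diff[of 0 z]
  by (auto simp: lattice_iff coord_simps coord_scale_int)

lemma lattice_omega: "\<omega>1 \<in> lattice" "\<omega>2 \<in> lattice"
  by (auto simp: lattice_iff coord_simps)

lemma lattice_sum: "(\<And>x. x \<in> A \<Longrightarrow> f x \<in> lattice) \<Longrightarrow> sum f A \<in> lattice"
  by (induction A rule: infinite_finite_induct) (auto intro: lattice_add lattice_0)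

text \<open>Half-open, so that every coset of the lattice has exactly one representative in
  it.\<close>

definition parallelogram :: "complex \<Rightarrow> complex set" where
  "parallelogram a = {z. 0 \<le> xcoord (z - a) \<and> xcoord (z - a) < 1 \<and> 0 \<le> ycoord (z - a) \<and> ycoord (z - a) < 1}"

definition reduce :: "complex \<Rightarrow> complex \<Rightarrow> complex" where
  "reduce a z = z - (of_int \<lfloor>xcoord (z - a)\<rfloor> * \<omega>1 + of_int \<lfloor>ycoord (z - a)\<rfloor> * \<omega>2)"

lemma reduce_in: "reduce a z \<in> parallelogram a"
  unfolding parallelogram_def reduce_def by (auto simp: coord_simps coord_scale_int; linarith)

lemma reduce_diff: "z - reduce a z \<in> lattice"
  unfolding reduce_def by (auto simp: lattice_iff coord_simps coord_scale_int)

lemma parallelogram_inject: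
  assumes "z \<in> parallelogram a" "w \<in> parallelogram a" "z - w \<in> lattice"
  shows "z = w"
proof (rule coord_inject)
  have *: "x = y" if "0 \<le> x - c" "x - c < 1" "0 \<le> y - c" "y - c < 1" "x - y \<in> \<int>" for x y c :: real
  proof -
    have "\<bar>x - y\<bar> < 1" using that by linarith
    then show ?thesis using Ints_nonzero_abs_less1[OF that(5)] by simp
  qed
  show "xcoord z = xcoord w" "ycoord z = ycoord w"
    using assms by (auto simp: parallelogram_def lattice_iff coord_simps intro!: *)
qed

lemma convex_coords:
  assumes "\<And>x y x' y' u v. P x y \<Longrightarrow> P x' y' \<Longrightarrow> 0 \<le> u \<Longrightarrow> 0 \<le> v \<Longrightarrow> u + v = 1 \<Longrightarrow>
     P (u * x + v * x') (u * y + v * y')"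
  shows "convex {z. P (xcoord (z - a)) (ycoord (z - a))}"
proof (rule convexI)
  fix z w :: complex and u v :: real
  assume *: "z \<in> {z. P (xcoord (z - a)) (ycoord (z - a))}" "w \<in> {z. P (xcoord (z - a)) (ycoord (z - a))}"
    "0 \<le> u" "0 \<le> v" "u + v = 1"
  have "u *\<^sub>R z + v *\<^sub>R w - a = u *\<^sub>R (z - a) + v *\<^sub>R (w - a)"
    using \<open>u + v = 1\<close> by (simp add: algebra_simps flip: scaleR_add_left)
  then show "u *\<^sub>R z + v *\<^sub>R w \<in> {z. P (xcoord (z - a)) (ycoord (z - a))}"
    using assms * by (simp add: coord_scaleR xcoord_add ycoord_add)
qed

lemma bounded_coords: "bounded {z. \<bar>xcoord z\<bar> \<le> A \<and> \<bar>ycoord z\<bar> \<le> B}"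
proof (rule boundedI)
  fix z assume "z \<in> {z. \<bar>xcoord z\<bar> \<le> A \<and> \<bar>ycoord z\<bar> \<le> B}"
  moreover have "norm z \<le> \<bar>xcoord z\<bar> * norm \<omega>1 + \<bar>ycoord z\<bar> * norm \<omega>2"
    by (subst coord_eq[of z], rule order.trans[OF norm_triangle_ineq]) (simp add: norm_mult)
  ultimately show "norm z \<le> A * norm \<omega>1 + B * norm \<omega>2"
    by (smt (verit) mem_Collect_eq mult_right_mono norm_ge_zero)
qed

section \<open>Winding numbers of the boundary path\<close>

definition boundary :: "complex \<Rightarrow> real \<Rightarrow> complex" where
  "boundary a = linepath a (a + \<omega>1) +++ linepath (a + \<omega>1) (a + \<omega>1 + \<omega>2) +++
     linepath (a + \<omega>1 + \<omega>2) (a + \<omega>2) +++ linepath (a + \<omega>2) a"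

lemma boundary_path: "valid_path (boundary a)" "path (boundary a)"
  "pathstart (boundary a) = a" "pathfinish (boundary a) = a"
  by (auto simp: boundary_def)

lemma path_image_boundary:
  "path_image (boundary a) = closed_segment a (a + \<omega>1) \<union> closed_segment (a + \<omega>1) (a + \<omega>1 + \<omega>2) \<union>
     closed_segment (a + \<omega>1 + \<omega>2) (a + \<omega>2) \<union> closed_segment (a + \<omega>2) a"
  by (auto simp: boundary_def path_image_join)

lemma coord_closed_segment:
  assumes "z \<in> closed_segment p q"
  obtains u where "0 \<le> u" "u \<le> 1" "xcoord z = (1 - u) * xcoord p + u * xcoord q"
    "ycoord z = (1 - u) * ycoord p + u * ycoord q"
  using assms by (force simp: closed_segment_def coord_simps coord_scaleR)

lemma path_image_boundary_coords:
  assumes "z \<in> path_image (boundary a)"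
  shows "0 \<le> xcoord (z - a)" "xcoord (z - a) \<le> 1" "0 \<le> ycoord (z - a)" "ycoord (z - a) \<le> 1"
    "xcoord (z - a) \<in> {0, 1} \<or> ycoord (z - a) \<in> {0, 1}"
  using assms unfolding path_image_boundary
  by (auto elim!: coord_closed_segment simp: coord_simps algebra_simps)


lemma winding_number_boundary_outside:
  assumes "\<not> (0 \<le> xcoord (z - a) \<and> xcoord (z - a) \<le> 1 \<and> 0 \<le> ycoord (z - a) \<and> ycoord (z - a) \<le> 1)"
  shows "winding_number (boundary a) z = 0"
proof (rule winding_number_zero_outside)
  define P where "P x y \<longleftrightarrow> 0 \<le> x \<and> x \<le> 1 \<and> 0 \<le> y \<and> y \<le> 1" for x y :: real
  show "convex {z. P (xcoord (z - a)) (ycoord (z - a))}"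
  proof (rule convex_coords)
    show "P (u * x + v * x') (u * y + v * y')"
      if "P x y" "P x' y'" "0 \<le> u" "0 \<le> v" "u + v = 1" for x y x' y' u v
      using that convex_bound_le[of x 1 x' u v] convex_bound_le[of y 1 y' u v] by (auto simp: P_def)
  qed
  show "path_image (boundary a) \<subseteq> {z. P (xcoord (z - a)) (ycoord (z - a))}"
    using path_image_boundary_coords by (auto simp: P_def)
  show "z \<notin> {z. P (xcoord (z - a)) (ycoord (z - a))}"
    using assms by (simp add: P_def)
qed (simp_all add: boundary_path)

text \<open>The parallelogram is split along the diagonal from \<open>a\<close> to \<open>a + \<omega>1 + \<omega>2\<close>.\<close>

lemma winding_number_boundary_centroid:
  defines "z \<equiv> \<lambda>a. a + (2/3) *\<^sub>R \<omega>1 + (1/3) *\<^sub>R \<omega>2"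
  shows "winding_number (boundary a) (z a) \<in> {1, -1}"
proof -
  let ?z = "z a"
  define b c d where "b = a + \<omega>1" and "c = a + \<omega>1 + \<omega>2" and "d = a + \<omega>2"
  have z: "xcoord ?z = xcoord a + 2/3" "ycoord ?z = ycoord a + 1/3"
    by (simp_all add: z_def coord_simps coord_scaleR)
  note coords = z b_def c_def d_def coord_simps
  have nin: "?z \<notin> closed_segment a b" "?z \<notin> closed_segment b c" "?z \<notin> closed_segment c d"
    "?z \<notin> closed_segment d a" "?z \<notin> closed_segment c a" "?z \<notin> closed_segment a c"
    by (auto elim!: coord_closed_segment simp: coords algebra_simps)
  \<comment> \<open>The point \<open>?z\<close> is the centroid of the triangle \<open>a\<close>,
    \<open>b\<close>, \<open>c\<close>.\<close>
  have T1: "winding_number (linepath a b +++ linepath b c +++ linepath c a) ?z \<in> {1, -1}"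
  proof -
    have "?z = (1/3) *\<^sub>R a + (1/3) *\<^sub>R b + (1/3) *\<^sub>R c"
      unfolding z_def b_def c_def by (simp add: scaleR_conv_of_real field_simps)
    then have "?z \<in> convex hull {a, b, c}"
      unfolding convex_hull_3 by (intro CollectI exI[of _ "1/3"] conjI) simp_all
    then have "?z \<in> interior (convex hull {a, b, c})"
      using nin by (simp add: interior_of_triangle)
    then show ?thesis
      by (simp add: winding_number_triangle)
  qed
  \<comment> \<open>The other triangle lies in the half-plane where the first coordinate relative to
    \<open>a\<close> is at most the second, whereas the centroid has coordinates 2/3 and
    1/3.\<close>
  have T2: "winding_number (linepath a c +++ linepath c d +++ linepath d a) ?z = 0"
  proof (rule winding_number_zero_outside)
    define P where "P x y \<longleftrightarrow> x \<le> y" for x y :: real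
    show conv: "convex {w. P (xcoord (w - a)) (ycoord (w - a))}"
      by (rule convex_coords) (auto simp: P_def intro!: add_mono mult_left_mono)
    have "{a, c, d} \<subseteq> {w. P (xcoord (w - a)) (ycoord (w - a))}"
      by (auto simp: P_def coords)
    then show "path_image (linepath a c +++ linepath c d +++ linepath d a)
        \<subseteq> {w. P (xcoord (w - a)) (ycoord (w - a))}"
      using closed_segment_subset[OF _ _ conv] by (simp add: path_image_join)
    show "?z \<notin> {w. P (xcoord (w - a)) (ycoord (w - a))}"
      by (simp add: P_def coords)
  qed auto
  \<comment> \<open>The two triangles run through the diagonal in opposite directions, so its
    contributions cancel.\<close>
  have "winding_number (linepath c a) ?z = - winding_number (linepath a c) ?z"
    using winding_number_reversepath[of "linepath a c" ?z] nin by simp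
  moreover have bnd: "boundary a = linepath a b +++ linepath b c +++ linepath c d +++ linepath d a"
    by (simp add: boundary_def b_def c_def d_def)
  ultimately have "winding_number (boundary a) ?z =
      winding_number (linepath a b +++ linepath b c +++ linepath c a) ?z +
      winding_number (linepath a c +++ linepath c d +++ linepath d a) ?z"
    unfolding bnd using nin by (simp add: winding_number_join path_image_join not_in_path_image_join)
  with T1 T2 show ?thesis by simp
qed

text \<open>The open parallelogram is connected and avoids the path, so the value at the centroid
  holds throughout. The sign \<open>\<sigma>\<close> stays open because the basis may have either
  orientation.\<close>

lemma winding_number_boundary_inside:
  obtains \<sigma> :: int where "\<bar>\<sigma>\<bar> = 1"
    "\<And>z. 0 < xcoord (z - a) \<Longrightarrow> xcoord (z - a) < 1 \<Longrightarrow> 0 < ycoord (z - a) \<Longrightarrow> ycoord (z - a) < 1 \<Longrightarrow>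
       winding_number (boundary a) z = of_int \<sigma>"
proof -
  define P where "P x y \<longleftrightarrow> 0 < x \<and> x < 1 \<and> 0 < y \<and> y < 1" for x y :: real
  let ?S = "{z. P (xcoord (z - a)) (ycoord (z - a))}"
  have "convex ?S"
  proof (rule convex_coords)
    show "P (u * x + v * x') (u * y + v * y')"
      if "P x y" "P x' y'" "0 \<le> u" "0 \<le> v" "u + v = 1" for x y x' y' u v
      using that convex_bound_lt[of x 1 x' u v] convex_bound_lt[of y 1 y' u v]
        convex_bound_lt[of "-x" 0 "-x'" u v] convex_bound_lt[of "-y" 0 "-y'" u v] by (auto simp: P_def)
  qed
  then have "connected ?S" by (rule convex_connected)
  moreover have "?S \<inter> path_image (boundary a) = {}"
    using path_image_boundary_coords(5) by (fastforce simp: P_def)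
  ultimately have "winding_number (boundary a) constant_on ?S"
    by (intro winding_number_constant) (auto simp: boundary_path)
  moreover define z0 where "z0 = a + (2/3) *\<^sub>R \<omega>1 + (1/3) *\<^sub>R \<omega>2"
  moreover have "z0 \<in> ?S"
    by (simp add: P_def z0_def coord_simps coord_scaleR)
  ultimately have eq: "winding_number (boundary a) z = winding_number (boundary a) z0" if "z \<in> ?S" for z
    using that unfolding constant_on_def by metis
  consider "winding_number (boundary a) z0 = of_int 1" | "winding_number (boundary a) z0 = of_int (-1)"
    using winding_number_boundary_centroid[of a] unfolding z0_def by auto
  then show ?thesis
    by cases (rule that[of 1] that[of "-1"]; use eq in \<open>simp add: P_def\<close>)+
qed


section \<open>The argument principle over a period parallelogram\<close>

lemma contour_integral_boundary:
  assumes "continuous_on (path_image (boundary a)) g"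
  shows "contour_integral (boundary a) g =
    contour_integral (linepath a (a + \<omega>1)) g - contour_integral (linepath a (a + \<omega>1)) (\<lambda>z. g (z + \<omega>2)) +
    contour_integral (linepath a (a + \<omega>2)) (\<lambda>z. g (z + \<omega>1)) - contour_integral (linepath a (a + \<omega>2)) g"
proof -
  have cont: "continuous_on (closed_segment a (a + \<omega>1)) g"
    "continuous_on (closed_segment (a + \<omega>1) (a + \<omega>1 + \<omega>2)) g"
    "continuous_on (closed_segment (a + \<omega>1 + \<omega>2) (a + \<omega>2)) g"
    "continuous_on (closed_segment (a + \<omega>2) a) g"
    using assms by (auto intro: continuous_on_subset simp: path_image_boundary)
  have "contour_integral (boundary a) g =
      contour_integral (linepath a (a + \<omega>1)) g + contour_integral (linepath (a + \<omega>1) (a + \<omega>1 + \<omega>2)) g +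
      contour_integral (linepath (a + \<omega>1 + \<omega>2) (a + \<omega>2)) g + contour_integral (linepath (a + \<omega>2) a) g"
    unfolding boundary_def using cont
    by (simp add: contour_integrable_continuous_linepath contour_integrable_joinI)
  also have "contour_integral (linepath (a + \<omega>1) (a + \<omega>1 + \<omega>2)) g =
      contour_integral (linepath a (a + \<omega>2)) (\<lambda>z. g (z + \<omega>1))"
    using contour_integral_linepath_shift[of a \<omega>1 "a + \<omega>2" g] by (simp add: ac_simps)
  also have "contour_integral (linepath (a + \<omega>1 + \<omega>2) (a + \<omega>2)) g =
      - contour_integral (linepath a (a + \<omega>1)) (\<lambda>z. g (z + \<omega>2))"
    using contour_integral_linepath_shift[of a \<omega>2 "a + \<omega>1" g]
      contour_integral_reverse_linepath[OF cont(3)] by (simp add: ac_simps)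
  also have "contour_integral (linepath (a + \<omega>2) a) g = - contour_integral (linepath a (a + \<omega>2)) g"
    by (rule contour_integral_reverse_linepath[OF cont(4)])
  finally show ?thesis by simp
qed

lemma bounded_parallelogram: "bounded (parallelogram a)"
  by (rule bounded_subset[OF bounded_coords[of "\<bar>xcoord a\<bar> + 1" "\<bar>ycoord a\<bar> + 1"]])
     (auto simp: parallelogram_def coord_simps)

definition periodic :: "(complex \<Rightarrow> 'a) \<Rightarrow> bool" where
  "periodic f \<longleftrightarrow> (\<forall>z. f (z + \<omega>1) = f z \<and> f (z + \<omega>2) = f z)"

text \<open>Integrate \<open>f' / f\<close> and \<open>z * f' / f\<close> over the boundary.
  Opposite edges cancel in the first integral. In the second they leave each period times the
  integral of \<open>f' / f\<close> along an edge in the other direction, which is an integer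
  multiple of \<open>2 * pi * \<i>\<close>. The assumption on \<open>a\<close> keeps zeros and poles
  off the boundary.\<close>

lemma divisor_sums_generic:
  assumes nice: "f nicely_meromorphic_on UNIV" and per: "periodic f"
    and nonzero: "eventually (\<lambda>z. f z \<noteq> 0) (cosparse UNIV)"
    and gen: "\<And>z. f z = 0 \<Longrightarrow> xcoord (z - a) \<notin> \<int> \<and> ycoord (z - a) \<notin> \<int>"
  defines "Z \<equiv> {z \<in> parallelogram a. f z = 0}"
  shows "(\<Sum>z\<in>Z. zorder f z) = 0" and "(\<Sum>z\<in>Z. of_int (zorder f z) * z) \<in> lattice"
proof -
  \<comment> \<open>The argument principle works on an open connected set. A ball around the closed
    parallelogram serves, since the additional zeros and poles in it have winding number 0.\<close>
  define K where "K = {z. \<bar>xcoord z\<bar> \<le> \<bar>xcoord a\<bar> + 1 \<and> \<bar>ycoord z\<bar> \<le> \<bar>ycoord a\<bar> + 1}"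
  obtain R where R: "K \<subseteq> ball 0 R"
    using bounded_subset_ballD[OF bounded_coords, of "\<bar>xcoord a\<bar> + 1" "\<bar>ycoord a\<bar> + 1" 0]
    unfolding K_def by blast
  define S where "S = ball (0 :: complex) R"
  have KI: "z \<in> S" if "0 \<le> xcoord (z - a)" "xcoord (z - a) \<le> 1" "0 \<le> ycoord (z - a)" "ycoord (z - a) \<le> 1" for z
  proof -
    have "z \<in> K" using that by (auto simp: K_def coord_simps)
    then show ?thesis using R by (auto simp: S_def)
  qed
  have pathS: "path_image (boundary a) \<subseteq> S"
    using path_image_boundary_coords KI by blast
  have path_nz: "f z \<noteq> 0" if "z \<in> path_image (boundary a)" for z
    using gen[of z] path_image_boundary_coords(5)[OF that] by auto
  \<comment> \<open>A nicely meromorphic function has the value 0 at its poles, so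
    \<open>f z = 0\<close> marks zeros and poles alike and \<open>Z\<close> carries the whole
    divisor.\<close>
  have pole_0: "f z = 0" if "is_pole f z" for z
    using is_pole_zero_at_nicely_mero[OF nice that] by simp
  have ana: "f analytic_on {z}" if "f z \<noteq> 0" for z
    using nicely_meromorphic_on_imp_analytic_at[OF nice] pole_0 that by blast
  have ana_path: "f analytic_on path_image (boundary a)"
    using ana path_nz analytic_on_analytic_at by blast
  have fin: "finite {z\<in>S. f z = 0}"
    using finite_zeros_bounded[OF nonzero, of S] by (simp add: S_def)
  have Z_sub: "Z \<subseteq> {z\<in>S. f z = 0}"
    using KI by (auto simp: Z_def parallelogram_def)
  obtain \<sigma> :: int where \<sigma>: "\<bar>\<sigma>\<bar> = 1" and wn_inside:
    "\<And>z. 0 < xcoord (z - a) \<Longrightarrow> xcoord (z - a) < 1 \<Longrightarrow> 0 < ycoord (z - a) \<Longrightarrow> ycoord (z - a) < 1 \<Longrightarrow>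
       winding_number (boundary a) z = of_int \<sigma>"
    using winding_number_boundary_inside[of a] by metis
  have wn_Z: "winding_number (boundary a) z = of_int \<sigma>" if "z \<in> Z" for z
  proof (rule wn_inside)
    show "0 < xcoord (z - a)" "0 < ycoord (z - a)" "xcoord (z - a) < 1" "ycoord (z - a) < 1"
      using that gen[of z] by (auto simp: Z_def parallelogram_def less_le)
  qed
  have wn_out: "winding_number (boundary a) z = 0" if "f z = 0" "z \<notin> Z" for z
  proof (rule winding_number_boundary_outside)
    show "\<not> (0 \<le> xcoord (z - a) \<and> xcoord (z - a) \<le> 1 \<and> 0 \<le> ycoord (z - a) \<and> ycoord (z - a) \<le> 1)"
      using that gen[of z] by (auto simp: Z_def parallelogram_def le_less)
  qed
  have AP: "contour_integral (boundary a) (\<lambda>x. deriv f x * h x / f x) =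
      2 * pi * \<i> * of_int \<sigma> * (\<Sum>z\<in>Z. of_int (zorder f z) * h z)"
    if h: "h holomorphic_on UNIV" for h
  proof -
    have pz: "{w\<in>S. f w = 0 \<or> w \<in> {z. is_pole f z}} = {z\<in>S. f z = 0}"
      using pole_0 by auto
    have "contour_integral (boundary a) (\<lambda>x. deriv f x * h x / f x) = 2 * pi * \<i> *
          (\<Sum>p\<in>{w\<in>S. f w = 0 \<or> w \<in> {z. is_pole f z}}. winding_number (boundary a) p * h p * zorder f p)"
    proof (rule argument_principle)
      show "f holomorphic_on S - {z. is_pole f z}"
        using nicely_meromorphic_on_imp_analytic_at[OF nice]
        by (intro analytic_imp_holomorphic) (auto simp: analytic_on_analytic_at[of _ "S - _"])
      show "h holomorphic_on S" using h by (rule holomorphic_on_subset) simp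
      show "\<forall>z. z \<notin> S \<longrightarrow> winding_number (boundary a) z = 0"
        using pathS by (auto intro!: winding_number_zero_outside[where s = S] simp: boundary_path S_def)
      show "path_image (boundary a) \<subseteq> S - {w\<in>S. f w = 0 \<or> w \<in> {z. is_pole f z}}"
        unfolding pz using pathS path_nz by auto
      show "finite {w\<in>S. f w = 0 \<or> w \<in> {z. is_pole f z}}"
        unfolding pz by (rule fin)
    qed (auto simp: S_def boundary_path)
    also have "(\<Sum>p\<in>{w\<in>S. f w = 0 \<or> w \<in> {z. is_pole f z}}. winding_number (boundary a) p * h p * zorder f p)
        = (\<Sum>p\<in>Z. winding_number (boundary a) p * h p * zorder f p)"
      unfolding pz by (intro sum.mono_neutral_right fin Z_sub) (auto simp: wn_out)
    also have "\<dots> = of_int \<sigma> * (\<Sum>z\<in>Z. of_int (zorder f z) * h z)"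
      unfolding sum_distrib_left by (intro sum.cong) (auto simp: wn_Z)
    finally show ?thesis by (simp add: mult.assoc)
  qed
  have cont: "continuous_on (path_image (boundary a)) (\<lambda>x. deriv f x * h x / f x)"
    if "h holomorphic_on UNIV" for h
    using path_nz ana_path holomorphic_on_subset[OF that subset_UNIV]
    by (intro continuous_intros)
       (auto intro!: holomorphic_on_imp_continuous_on intro: analytic_imp_holomorphic analytic_deriv)
  have per_f: "f (z + \<omega>1) = f z" "f (z + \<omega>2) = f z" for z
    using per by (auto simp: periodic_def)
  have per_d: "deriv f (z + \<omega>1) = deriv f z" "deriv f (z + \<omega>2) = deriv f z" for z
  proof -
    have "f \<circ> (+) (z + \<omega>1) = f \<circ> (+) z" "f \<circ> (+) (z + \<omega>2) = f \<circ> (+) z"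
      using per_f(1)[of "z + w" for w] per_f(2)[of "z + w" for w] by (auto simp: fun_eq_iff ac_simps)
    then show "deriv f (z + \<omega>1) = deriv f z" "deriv f (z + \<omega>2) = deriv f z"
      by (metis deriv_shift_0)+
  qed
  have [simp]: "\<sigma> \<noteq> 0" using \<sigma> by auto
  have "contour_integral (boundary a) (\<lambda>x. deriv f x * 1 / f x) = 0"
    by (subst contour_integral_boundary[OF cont]) (simp_all add: per_f per_d)
  then have "(\<Sum>z\<in>Z. of_int (zorder f z)) = (0 :: complex)"
    by (subst (asm) AP) auto
  then show "(\<Sum>z\<in>Z. zorder f z) = 0"
    by (metis of_int_0_eq_iff of_int_sum)
  define E1 E2 where "E1 = contour_integral (linepath a (a + \<omega>1))" and "E2 = contour_integral (linepath a (a + \<omega>2))"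
  define L where "L z = deriv f z / f z" for z
  define G where "G x = deriv f x * x / f x" for x
  have contL: "continuous_on (path_image (boundary a)) L"
    using cont[of "\<lambda>_. 1"] by (simp add: L_def[abs_def])
  have contG: "continuous_on (path_image (boundary a)) G"
    using cont[of "\<lambda>z. z"] by (simp add: G_def[abs_def])
  have seg: "closed_segment a (a + \<omega>1) \<subseteq> path_image (boundary a)" "closed_segment a (a + \<omega>2) \<subseteq> path_image (boundary a)"
    by (auto simp: path_image_boundary closed_segment_commute)
  obtain k1 :: int where k1: "E1 L = 2 * pi * \<i> * of_int k1"
    using seg(1) ana_path path_nz per_f unfolding E1_def L_def
    by (rule_tac contour_integral_logderiv_periodic[of f "linepath a (a + \<omega>1)"])
       (auto intro: analytic_on_subset)
  obtain k2 :: int where k2: "E2 L = 2 * pi * \<i> * of_int k2"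
    using seg(2) ana_path path_nz per_f unfolding E2_def L_def
    by (rule_tac contour_integral_logderiv_periodic[of f "linepath a (a + \<omega>2)"])
       (auto intro: analytic_on_subset)
  have int: "L contour_integrable_on linepath a (a + \<omega>1)" "L contour_integrable_on linepath a (a + \<omega>2)"
    "G contour_integrable_on linepath a (a + \<omega>1)" "G contour_integrable_on linepath a (a + \<omega>2)"
    using seg contL contG by (auto intro!: contour_integrable_continuous_linepath intro: continuous_on_subset)
  have "contour_integral (boundary a) G = E1 G - E1 (\<lambda>z. G (z + \<omega>2)) + E2 (\<lambda>z. G (z + \<omega>1)) - E2 G"
    unfolding E1_def E2_def by (rule contour_integral_boundary[OF contG])
  \<comment> \<open>The weight \<open>z\<close> is the only factor of \<open>G\<close> that is not
    periodic; its increment is the period.\<close>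
  also have "(\<lambda>z. G (z + \<omega>2)) = (\<lambda>z. G z + \<omega>2 * L z)"
    by (auto simp: G_def L_def per_f per_d add_divide_distrib algebra_simps)
  also have "(\<lambda>z. G (z + \<omega>1)) = (\<lambda>z. G z + \<omega>1 * L z)"
    by (auto simp: G_def L_def per_f per_d add_divide_distrib algebra_simps)
  also have "E1 (\<lambda>z. G z + \<omega>2 * L z) = E1 G + \<omega>2 * E1 L"
    unfolding E1_def using int by (simp add: contour_integral_add contour_integral_lmul contour_integrable_lmul)
  also have "E2 (\<lambda>z. G z + \<omega>1 * L z) = E2 G + \<omega>1 * E2 L"
    unfolding E2_def using int by (simp add: contour_integral_add contour_integral_lmul contour_integrable_lmul)
  finally have "contour_integral (boundary a) G = 2 * pi * \<i> * (of_int k2 * \<omega>1 + of_int (- k1) * \<omega>2)"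
    by (simp add: k1 k2 algebra_simps)
  moreover have "contour_integral (boundary a) G = 2 * pi * \<i> * (of_int \<sigma> * (\<Sum>z\<in>Z. of_int (zorder f z) * z))"
    unfolding G_def by (subst AP) (auto intro: holomorphic_intros)
  ultimately have "of_int \<sigma> * (\<Sum>z\<in>Z. of_int (zorder f z) * z) = of_int k2 * \<omega>1 + of_int (- k1) * \<omega>2"
    by simp
  then have "of_int \<sigma> * (\<Sum>z\<in>Z. of_int (zorder f z) * z) \<in> lattice"
    unfolding lattice_def by blast
  \<comment> \<open>A second factor \<open>\<sigma>\<close> removes the unknown orientation, because
    its square is 1.\<close>
  then have "of_int \<sigma> * (of_int \<sigma> * (\<Sum>z\<in>Z. of_int (zorder f z) * z)) \<in> lattice"
    by (rule lattice_of_int)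
  moreover have "of_int \<sigma> * of_int \<sigma> = (1 :: complex)"
    using \<sigma> by (auto simp: abs_if split: if_splits)
  ultimately show "(\<Sum>z\<in>Z. of_int (zorder f z) * z) \<in> lattice"
    by (simp flip: mult.assoc)
qed


section \<open>Moving the base point of the parallelogram\<close>

lemma periodic_lattice:
  assumes "periodic f" "l \<in> lattice"
  shows "f (z + l) = f z"
proof -
  have nat: "f (z + of_nat k * w) = f z" if "\<And>z. f (z + w) = f z" for k z w
  proof (induction k)
    case (Suc k)
    have "z + of_nat (Suc k) * w = (z + of_nat k * w) + w" by (simp add: algebra_simps)
    then show ?case using Suc that[of "z + of_nat k * w"] by (simp only:)
  qed simp
  have int: "f (z + of_int k * w) = f z" if w: "\<And>z. f (z + w) = f z" for k z w
  proof (cases "k \<ge> 0")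
    case True
    then show ?thesis using nat[OF w, of z "nat k"] by simp
  next
    case False
    then show ?thesis using nat[OF w, of "z + of_int k * w" "nat (- k)"] by simp
  qed
  obtain m n where "l = of_int m * \<omega>1 + of_int n * \<omega>2"
    using assms(2) unfolding lattice_def by blast
  then have "f (z + l) = f ((z + of_int m * \<omega>1) + of_int n * \<omega>2)" by (simp add: add.assoc)
  also have "\<dots> = f z"
    using assms(1) by (simp add: periodic_def int)
  finally show ?thesis .
qed

lemma periodic_zorder: "periodic f \<Longrightarrow> periodic (zorder f)"
proof -
  assume f: "periodic f"
  have "zorder f (z + w) = zorder f z" if "\<And>z. f (z + w) = f z" for z w
  proof -
    have "(\<lambda>u. f (u + (z + w))) = (\<lambda>u. f (u + z))" using that by (simp flip: add.assoc)
    then show ?thesis by (subst (1 2) zorder_shift) simp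
  qed
  then show ?thesis using f by (simp add: periodic_def)
qed

lemma reduce_periodic:
  assumes "periodic f"
  shows "f (reduce a z) = f z"
  using periodic_lattice[OF assms reduce_diff[of z a], of "reduce a z"] by simp

lemma bij_betw_reduce:
  assumes "periodic P"
  shows "bij_betw (reduce a) {z \<in> parallelogram b. P z} {z \<in> parallelogram a. P z}"
proof (rule bij_betw_byWitness[where f' = "reduce b"])
  have "reduce c (reduce d z) = z" if "z \<in> parallelogram c" for c d z
  proof (rule parallelogram_inject[OF reduce_in that])
    have "- ((reduce d z - reduce c (reduce d z)) + (z - reduce d z)) \<in> lattice"
      by (intro lattice_uminus lattice_add reduce_diff)
    then show "reduce c (reduce d z) - z \<in> lattice" by simp
  qed
  then show "\<forall>z\<in>{z \<in> parallelogram b. P z}. reduce b (reduce a z) = z"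
    "\<forall>z\<in>{z \<in> parallelogram a. P z}. reduce a (reduce b z) = z" by auto
qed (use reduce_in reduce_periodic[OF assms] in auto)

text \<open>Modulo the lattice there are finitely many bad points, hence finitely many bad values in
  \<open>{0..<1}\<close> for each coordinate of \<open>a\<close>.\<close>

lemma ex_generic_base:
  assumes per: "periodic P" and fin: "finite {z \<in> parallelogram 0. P z}"
  obtains a where "\<And>z. P z \<Longrightarrow> xcoord (z - a) \<notin> \<int> \<and> ycoord (z - a) \<notin> \<int>"
proof -
  define Z where "Z = {z \<in> parallelogram 0. P z}"
  have ex: "\<exists>x\<in>{0..<1}. x \<notin> A" if "finite A" for A :: "real set"
    using finite_subset[OF _ that, of "{0..<1}"] infinite_Ico[of "0::real" 1, OF zero_less_one] by blast
  have fin_Z: "finite Z" using fin by (simp add: Z_def)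
  obtain x where x: "x \<in> {0..<1}" "x \<notin> xcoord ` Z"
    using ex[OF finite_imageI[OF fin_Z]] by metis
  obtain y where y: "y \<in> {0..<1}" "y \<notin> ycoord ` Z"
    using ex[OF finite_imageI[OF fin_Z]] by metis
  have *: "u = v" if "u \<in> {0..<1}" "v \<in> {0..<1}" "w - u \<in> \<int>" "w - v \<in> \<int>" for u v w :: real
  proof -
    have "(w - v) - (w - u) \<in> \<int>" by (rule Ints_diff[OF that(4,3)])
    moreover have "\<bar>(w - v) - (w - u)\<bar> < 1" using that by auto
    ultimately show ?thesis using Ints_nonzero_abs_less1 by fastforce
  qed
  show ?thesis
  proof (rule that[of "of_real x * \<omega>1 + of_real y * \<omega>2"])
    fix z assume "P z"
    then have Z: "reduce 0 z \<in> Z"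
      using reduce_in reduce_periodic[OF per] by (auto simp: Z_def)
    have para: "xcoord (reduce 0 z) \<in> {0..<1}" "ycoord (reduce 0 z) \<in> {0..<1}"
      using reduce_in[of 0 z] by (auto simp: parallelogram_def)
    have int: "xcoord z - xcoord (reduce 0 z) \<in> \<int>" "ycoord z - ycoord (reduce 0 z) \<in> \<int>"
      using reduce_diff[of z 0] by (auto simp: lattice_iff coord_simps)
    show "xcoord (z - (of_real x * \<omega>1 + of_real y * \<omega>2)) \<notin> \<int> \<and>
          ycoord (z - (of_real x * \<omega>1 + of_real y * \<omega>2)) \<notin> \<int>"
      using *[OF x(1) para(1) _ int(1)] *[OF y(1) para(2) _ int(2)] x(2) y(2) Z
      by (auto simp: coord_simps)
  qed
qed

text \<open>Removing singularities changes no order, and it makes the points of nonzero order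
  exactly the points of value 0. The generic case then applies to a shifted parallelogram. Moving
  each zero or pole back by a lattice vector keeps the first sum and changes the second by an
  integer combination of lattice vectors.\<close>

theorem divisor_sums:
  assumes mero: "f meromorphic_on UNIV" and per: "periodic f"
    and nonzero: "eventually (\<lambda>z. f z \<noteq> 0) (cosparse UNIV)"
  defines "Z \<equiv> {z \<in> parallelogram 0. zorder f z \<noteq> 0}"
  shows "finite Z" and "(\<Sum>z\<in>Z. zorder f z) = 0" and "(\<Sum>z\<in>Z. of_int (zorder f z) * z) \<in> lattice"
proof -
  define g where "g = remove_sings f"
  have g_nice: "g nicely_meromorphic_on UNIV"
    unfolding g_def by (rule remove_sings_nicely_meromorphic) fact
  have iso: "isolated_singularity_at f z" for z
    using mero by (simp add: meromorphic_on_altdef)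
  have zg: "zorder g z = zorder f z" for z
    unfolding g_def using iso by simp
  have g_nz: "eventually (\<lambda>z. g z \<noteq> 0) (cosparse UNIV)"
    using eventually_remove_sings_eq[OF mero] nonzero by eventually_elim (simp add: g_def)
  then have g_ev: "eventually (\<lambda>w. g w \<noteq> 0) (at z)" for z
    by (simp add: eventually_cosparse_open_eq)
  have shift: "g (z + w) = g z" if "\<And>z. f (z + w) = f z" for z w
  proof -
    have "(\<lambda>u. f (z + w + u)) = (\<lambda>u. f (z + u))" using that[of "z + u" for u] by (simp add: ac_simps)
    then show ?thesis unfolding g_def by (subst (1 2) remove_sings_shift_0) simp
  qed
  have g_per: "periodic g"
    using shift per by (simp add: periodic_def)
  have g_zero: "g z = 0 \<longleftrightarrow> zorder g z \<noteq> 0" for z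
  proof (cases "g z = 0")
    case True
    have "isolated_singularity_at g z" unfolding g_def using iso by simp
    moreover have "isolated_zero g z \<or> is_pole g z"
      using zero_or_pole[OF g_nice _ True g_ev] by simp
    ultimately have "zorder g z \<noteq> 0"
      using zorder_isolated_zero_pos' isolated_pole_imp_neg_zorder by fastforce
    then show ?thesis using True by simp
  next
    case False
    then have "\<not> is_pole g z" using is_pole_zero_at_nicely_mero[OF g_nice] by auto
    then have "g analytic_on {z}" using nicely_meromorphic_on_imp_analytic_at[OF g_nice] by simp
    then have "zorder g z = 0"
      using False g_ev[of z] by (subst zorder_eq_0_iff) (auto intro: eventually_frequently)
    then show ?thesis using False by simp
  qed
  have Z_eq: "Z = {z \<in> parallelogram 0. g z = 0}"
    unfolding Z_def g_zero by (simp add: zg)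
  show fin: "finite Z"
    using finite_zeros_bounded[OF g_nz bounded_parallelogram] by (simp add: Z_eq)
  have per0: "periodic (\<lambda>z. g z = 0)"
    using g_per by (simp add: periodic_def)
  obtain a where gen: "\<And>z. g z = 0 \<Longrightarrow> xcoord (z - a) \<notin> \<int> \<and> ycoord (z - a) \<notin> \<int>"
    using ex_generic_base[OF per0] fin unfolding Z_eq by metis
  note bij = bij_betw_reduce[OF per0, of a 0, folded Z_eq]
  have zred: "zorder g (reduce a z) = zorder g z" for z
    by (rule reduce_periodic[OF periodic_zorder[OF g_per]])
  have "(\<Sum>z\<in>Z. zorder g z) = 0"
    using divisor_sums_generic(1)[OF g_nice g_per g_nz gen] sum.reindex_bij_betw[OF bij, of "zorder g"]
    by (simp add: zred)
  then show "(\<Sum>z\<in>Z. zorder f z) = 0" by (simp add: zg)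
  have "(\<Sum>z\<in>Z. of_int (zorder g z) * reduce a z) \<in> lattice"
    using divisor_sums_generic(2)[OF g_nice g_per g_nz gen]
      sum.reindex_bij_betw[OF bij, of "\<lambda>z. of_int (zorder g z) * z"]
    by (simp add: zred)
  moreover have "(\<Sum>z\<in>Z. of_int (zorder g z) * (z - reduce a z)) \<in> lattice"
    by (intro lattice_sum lattice_of_int reduce_diff)
  ultimately have "(\<Sum>z\<in>Z. of_int (zorder g z) * reduce a z) + (\<Sum>z\<in>Z. of_int (zorder g z) * (z - reduce a z)) \<in> lattice"
    by (rule lattice_add)
  then show "(\<Sum>z\<in>Z. of_int (zorder f z) * z) \<in> lattice"
    by (simp add: zg algebra_simps flip: sum.distrib)
qed

end


subsection \<open>Polynomial functions in three variables\<close>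

text \<open>An inductive closure, so that meromorphy, holomorphy and differentiability are proved by
  rule induction instead of through coefficients.\<close>

inductive poly3 :: "(complex ^ 3 \<Rightarrow> complex) \<Rightarrow> bool" where
  const: "poly3 (\<lambda>_. c)"
| coord: "poly3 (\<lambda>v. v $ i)"
| add: "poly3 F \<Longrightarrow> poly3 G \<Longrightarrow> poly3 (\<lambda>v. F v + G v)"
| mult: "poly3 F \<Longrightarrow> poly3 G \<Longrightarrow> poly3 (\<lambda>v. F v * G v)"

lemma poly3_power: "poly3 F \<Longrightarrow> poly3 (\<lambda>v. F v ^ n)"
  by (induction n) (auto intro: poly3.intros)

lemma poly3_sum: "(\<And>i. i \<in> A \<Longrightarrow> poly3 (F i)) \<Longrightarrow> poly3 (\<lambda>v. \<Sum>i\<in>A. F i v)"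
  by (induction A rule: infinite_finite_induct) (auto intro: poly3.intros)

lemma poly3_diff: "poly3 F \<Longrightarrow> poly3 G \<Longrightarrow> poly3 (\<lambda>v. F v - G v)"
  using poly3.add[OF _ poly3.mult[OF poly3.const[of "-1"]], of F G] by simp

lemmas poly3_intros = poly3.intros poly3_power poly3_sum poly3_diff

lemma poly3_meromorphic:
  "poly3 F \<Longrightarrow> (\<And>i. (\<lambda>w. \<phi> w $ i) meromorphic_on A) \<Longrightarrow> (\<lambda>w. F (\<phi> w)) meromorphic_on A"
  by (induction rule: poly3.induct) (auto intro: meromorphic_intros)

lemma poly3_holomorphic:
  "poly3 F \<Longrightarrow> (\<And>i. (\<lambda>w. \<phi> w $ i) holomorphic_on A) \<Longrightarrow> (\<lambda>w. F (\<phi> w)) holomorphic_on A"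
  by (induction rule: poly3.induct) (auto intro: holomorphic_intros)

text \<open>The gradient clause connects to \<open>singular_points\<close>. The last clause is the
  complex chain rule along curves, which serves the tangency and transversality arguments.\<close>

definition partials :: "(complex ^ 3 \<Rightarrow> complex) \<Rightarrow> (3 \<Rightarrow> complex ^ 3 \<Rightarrow> complex) \<Rightarrow> bool" where
  "partials F G \<longleftrightarrow> (\<forall>i. poly3 (G i)) \<and> (\<forall>v. has_gradient F (\<chi> i. G i v) v) \<and>
    (\<forall>\<phi> d z. (\<forall>i. ((\<lambda>w. \<phi> w $ i) has_field_derivative d i) (at z)) \<longrightarrow>
       ((\<lambda>w. F (\<phi> w)) has_field_derivative (\<Sum>i\<in>UNIV. G i (\<phi> z) * d i)) (at z))"

lemma partials_DERIV:
  assumes "partials F G" "\<And>i. ((\<lambda>w. \<phi> w $ i) has_field_derivative d i) (at z)"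
  shows "((\<lambda>w. F (\<phi> w)) has_field_derivative (\<Sum>i\<in>UNIV. G i (\<phi> z) * d i)) (at z)"
  using assms unfolding partials_def by blast

lemma ex_partials:
  assumes "poly3 F"
  shows "\<exists>G. partials F G"
  unfolding partials_def
  using assms
proof (induction rule: poly3.induct)
  case (const c)
  show ?case
    by (rule exI[of _ "\<lambda>_ _. 0"]) (auto intro: poly3.intros simp: has_gradient_def)
next
  case (coord j)
  have "((\<lambda>v :: complex ^ 3. v $ j) has_derivative (\<lambda>h. h $ j)) (at v)" for v
    by (rule bounded_linear_imp_has_derivative[OF bounded_linear_vec_nth])
  then show ?case
    by (intro exI[of _ "\<lambda>i _. if i = j then 1 else 0"])
       (auto intro: poly3.intros simp: has_gradient_def if_distrib[of "\<lambda>x. x * _"] cong: if_cong)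
next
  case (add F1 F2)
  then obtain G1 G2 where "\<forall>i. poly3 (G1 i)" "\<forall>v. has_gradient F1 (\<chi> i. G1 i v) v"
    "\<forall>\<phi> d z. (\<forall>i. ((\<lambda>w. \<phi> w $ i) has_field_derivative d i) (at z)) \<longrightarrow>
       ((\<lambda>w. F1 (\<phi> w)) has_field_derivative (\<Sum>i\<in>UNIV. G1 i (\<phi> z) * d i)) (at z)"
    "\<forall>i. poly3 (G2 i)" "\<forall>v. has_gradient F2 (\<chi> i. G2 i v) v"
    "\<forall>\<phi> d z. (\<forall>i. ((\<lambda>w. \<phi> w $ i) has_field_derivative d i) (at z)) \<longrightarrow>
       ((\<lambda>w. F2 (\<phi> w)) has_field_derivative (\<Sum>i\<in>UNIV. G2 i (\<phi> z) * d i)) (at z)"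
    by blast
  then show ?case
    by (intro exI[of _ "\<lambda>i v. G1 i v + G2 i v"])
       (auto intro: poly3.intros simp: has_gradient_def distrib_right sum.distrib
         intro!: has_derivative_add DERIV_add)
next
  case (mult F1 F2)
  then obtain G1 G2 where G: "\<forall>i. poly3 (G1 i)" "\<forall>v. has_gradient F1 (\<chi> i. G1 i v) v"
    "\<forall>\<phi> d z. (\<forall>i. ((\<lambda>w. \<phi> w $ i) has_field_derivative d i) (at z)) \<longrightarrow>
       ((\<lambda>w. F1 (\<phi> w)) has_field_derivative (\<Sum>i\<in>UNIV. G1 i (\<phi> z) * d i)) (at z)"
    "\<forall>i. poly3 (G2 i)" "\<forall>v. has_gradient F2 (\<chi> i. G2 i v) v"
    "\<forall>\<phi> d z. (\<forall>i. ((\<lambda>w. \<phi> w $ i) has_field_derivative d i) (at z)) \<longrightarrow>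
       ((\<lambda>w. F2 (\<phi> w)) has_field_derivative (\<Sum>i\<in>UNIV. G2 i (\<phi> z) * d i)) (at z)"
    by blast
  show ?case
  proof (intro exI[of _ "\<lambda>i v. F1 v * G2 i v + G1 i v * F2 v"] conjI allI impI)
    show "poly3 (\<lambda>v. F1 v * G2 i v + G1 i v * F2 v)" for i
      using G(1,4) mult(1,2) by (intro poly3.add poly3.mult) auto
    have *: "(\<Sum>i\<in>UNIV. (F1 v * G2 i v + G1 i v * F2 v) * h i)
        = F1 v * (\<Sum>i\<in>UNIV. G2 i v * h i) + (\<Sum>i\<in>UNIV. G1 i v * h i) * F2 v" for v and h :: "3 \<Rightarrow> complex"
      by (simp add: sum_distrib_left sum_distrib_right algebra_simps flip: sum.distrib)
    show "has_gradient (\<lambda>v. F1 v * F2 v) (\<chi> i. F1 v * G2 i v + G1 i v * F2 v) v" for v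
      using G(2,5) by (auto simp: has_gradient_def * intro!: has_derivative_mult)
    fix \<phi> :: "complex \<Rightarrow> complex ^ 3" and d z assume "\<forall>i. ((\<lambda>w. \<phi> w $ i) has_field_derivative d i) (at z)"
    with G(3,6) show "((\<lambda>w. F1 (\<phi> w) * F2 (\<phi> w)) has_field_derivative
        (\<Sum>i\<in>UNIV. (F1 (\<phi> z) * G2 i (\<phi> z) + G1 i (\<phi> z) * F2 (\<phi> z)) * d i)) (at z)"
      unfolding * by (intro DERIV_mult') auto
  qed
qed

section \<open>Homogeneous forms and their restriction to lines\<close>

definition form3 :: "nat \<Rightarrow> (complex ^ 3 \<Rightarrow> complex) \<Rightarrow> bool" where
  "form3 d F \<longleftrightarrow> poly3 F \<and> (\<forall>r v. F (r *s v) = r ^ d * F v)"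

lemma form3_poly3: "form3 d F \<Longrightarrow> poly3 F"
  and form3_scale: "form3 d F \<Longrightarrow> F (r *s v) = r ^ d * F v"
  by (auto simp: form3_def)

lemma form3_coord: "form3 1 (\<lambda>v. v $ i)"
  by (simp add: form3_def poly3.coord)

lemma ternary_form_imp_form3:
  assumes "ternary_form d F"
  shows "form3 d F"
proof -
  obtain a where F: "\<And>v. F v = (\<Sum>i\<le>d. \<Sum>j\<le>d - i. a i j * (v $ 1) ^ i * (v $ 2) ^ j * (v $ 3) ^ (d - i - j))"
    using assms unfolding ternary_form_def by blast
  have "poly3 F"
    unfolding F[abs_def] by (intro poly3_intros)
  moreover have "F (r *s v) = r ^ d * F v" for r v
  proof -
    have "a i j * (r * v $ 1) ^ i * (r * v $ 2) ^ j * (r * v $ 3) ^ (d - i - j) =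
        r ^ d * (a i j * (v $ 1) ^ i * (v $ 2) ^ j * (v $ 3) ^ (d - i - j))" if "i \<le> d" "j \<le> d - i" for i j
    proof -
      have "r ^ d = r ^ i * r ^ j * r ^ (d - i - j)"
        using that by (simp flip: power_add)
      then show ?thesis by (simp add: power_mult_distrib algebra_simps)
    qed
    then show ?thesis
      unfolding F sum_distrib_left vector_smult_component by (intro sum.cong refl) auto
  qed
  ultimately show ?thesis by (simp add: form3_def)
qed

lemma coeff_mult_top:
  fixes p q :: "'a :: comm_semiring_0 poly"
  assumes "degree p \<le> m" "degree q \<le> n"
  shows "coeff (p * q) (m + n) = coeff p m * coeff q n"
proof -
  have "coeff (p * q) (m + n) = (\<Sum>i\<le>m + n. coeff p i * coeff q (m + n - i))"
    by (rule coeff_mult)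
  also have "\<dots> = (\<Sum>i\<in>{m}. coeff p i * coeff q (m + n - i))"
  proof (rule sum.mono_neutral_right)
    show "\<forall>i\<in>{..m + n} - {m}. coeff p i * coeff q (m + n - i) = 0"
    proof
      fix i assume "i \<in> {..m + n} - {m}"
      then have "degree p < i \<or> degree q < m + n - i" using assms by auto
      then show "coeff p i * coeff q (m + n - i) = 0" by (auto simp: coeff_eq_0)
    qed
  qed auto
  finally show ?thesis by simp
qed

lemma linear_power_top:
  fixes a b :: "'a :: comm_semiring_1"
  shows "degree ([:a, b:] ^ n) \<le> n" "coeff ([:a, b:] ^ n) n = b ^ n"
proof (induction n)
  case (Suc n)
  have "degree [:a, b:] \<le> 1" by simp
  then show "coeff ([:a, b:] ^ Suc n) (Suc n) = b ^ Suc n"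
    using coeff_mult_top[of "[:a, b:]" 1 "[:a, b:] ^ n" n] Suc by simp
  show "degree ([:a, b:] ^ Suc n) \<le> Suc n"
    using degree_mult_le[of "[:a, b:]" "[:a, b:] ^ n"] Suc \<open>degree [:a, b:] \<le> 1\<close> by simp
qed auto

text \<open>A monomial becomes a product of \<open>d\<close> linear polynomials in \<open>u\<close>,
  so its coefficient of \<open>u ^ d\<close> is the monomial evaluated at \<open>b\<close>. Hence
  the degree is exactly \<open>d\<close> if the direction \<open>b\<close> is off the curve.\<close>

lemma ternary_form_line:
  assumes "ternary_form d F"
  shows "\<exists>p. degree p \<le> d \<and> coeff p d = F b \<and> (\<forall>u. poly p u = F (a + u *s b))"
proof -
  obtain c where F: "\<And>v. F v = (\<Sum>i\<le>d. \<Sum>j\<le>d - i. c i j * (v $ 1) ^ i * (v $ 2) ^ j * (v $ 3) ^ (d - i - j))"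
    using assms unfolding ternary_form_def by blast
  define l where "l k = [:a $ k, b $ k:]" for k
  define q where "q i j = smult (c i j) (l 1 ^ i * l 2 ^ j * l 3 ^ (d - i - j))" for i j
  define p where "p = (\<Sum>i\<le>d. \<Sum>j\<le>d - i. q i j)"
  have dq: "degree (q i j) \<le> d" and cq: "coeff (q i j) d = c i j * (b $ 1) ^ i * (b $ 2) ^ j * (b $ 3) ^ (d - i - j)"
    if "i \<le> d" "j \<le> d - i" for i j
  proof -
    have d2: "degree (l 1 ^ i * l 2 ^ j) \<le> i + j"
      by (intro order.trans[OF degree_mult_le] add_mono) (simp_all add: l_def linear_power_top)
    have ij: "i + j + (d - i - j) = d" using that by simp
    have "degree (l 1 ^ i * l 2 ^ j * l 3 ^ (d - i - j)) \<le> i + j + (d - i - j)"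
      using d2 by (intro order.trans[OF degree_mult_le] add_mono) (simp_all add: l_def linear_power_top)
    then show "degree (q i j) \<le> d"
      unfolding ij q_def by (rule order.trans[OF degree_smult_le])
    have "coeff (l 1 ^ i * l 2 ^ j * l 3 ^ (d - i - j)) (i + j + (d - i - j))
        = (b $ 1) ^ i * (b $ 2) ^ j * (b $ 3) ^ (d - i - j)"
      by (subst coeff_mult_top[OF d2] coeff_mult_top, simp_all add: linear_power_top l_def)+
    then show "coeff (q i j) d = c i j * (b $ 1) ^ i * (b $ 2) ^ j * (b $ 3) ^ (d - i - j)"
      unfolding ij by (simp add: q_def)
  qed
  show ?thesis
  proof (intro exI[of _ p] conjI allI)
    show "degree p \<le> d" unfolding p_def by (intro degree_sum_le) (auto simp: dq)
    show "coeff p d = F b" unfolding p_def F by (simp add: coeff_sum cq)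
    show "poly p u = F (a + u *s b)" for u
      unfolding p_def F by (simp add: poly_sum q_def l_def algebra_simps)
  qed
qed

text \<open>Differentiate \<open>F (w *s v) = w ^ d * F v\<close> in \<open>w\<close> at 1.\<close>

lemma form3_euler:
  assumes F: "form3 d F" and G: "partials F G"
  shows "(\<Sum>i\<in>UNIV. G i v * v $ i) = of_nat d * F v"
proof -
  have "((\<lambda>w. F (w *s v)) has_field_derivative (\<Sum>i\<in>UNIV. G i (1 *s v) * v $ i)) (at 1)"
    by (rule partials_DERIV[OF G]) (auto intro!: derivative_eq_intros)
  moreover have "((\<lambda>w. F (w *s v)) has_field_derivative of_nat d * F v) (at 1)"
    unfolding form3_scale[OF F] by (auto intro!: derivative_eq_intros)
  ultimately show ?thesis by (auto dest: DERIV_unique)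
qed

text \<open>The derivative of \<open>F\<close> at \<open>r *s v\<close> along a coordinate axis is
  computed directly and again after pulling out the factor \<open>r\<close>. This carries a
  vanishing gradient from one representative of a projective point to all others.\<close>

lemma form3_partial_scale_zero:
  assumes F: "form3 d F" and G: "partials F G"
    and "G i v = 0" "r \<noteq> 0"
  shows "G i (r *s v) = 0"
proof -
  define e where "e = (axis i 1 :: complex ^ 3)"
  have D: "((\<lambda>u. F (x + (b * u) *s e)) has_field_derivative b * G i x) (at 0)" for x b
  proof -
    have "((\<lambda>u. F (x + (b * u) *s e)) has_field_derivative (\<Sum>j\<in>UNIV. G j (x + (b * 0) *s e) * (b * e $ j))) (at 0)"
      by (rule partials_DERIV[OF G]) (auto intro!: derivative_eq_intros)
    then show ?thesis by (simp add: e_def axis_def if_distrib[of "\<lambda>x. _ * x"] mult.commute cong: if_cong)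
  qed
  have "F (r *s v + (1 * u) *s e) = r ^ d * F (v + (inverse r * u) *s e)" for u
  proof -
    have "r *s v + (1 * u) *s e = r *s (v + (inverse r * u) *s e)"
      using \<open>r \<noteq> 0\<close> by (simp add: vec_eq_iff field_simps)
    then show ?thesis by (simp only: form3_scale[OF F])
  qed
  then have "((\<lambda>u. r ^ d * F (v + (inverse r * u) *s e)) has_field_derivative G i (r *s v)) (at 0)"
    using D[of "r *s v" 1] by simp
  moreover have "((\<lambda>u. r ^ d * F (v + (inverse r * u) *s e)) has_field_derivative r ^ d * (inverse r * G i v)) (at 0)"
    by (intro DERIV_cmult D)
  ultimately show ?thesis using assms by (auto dest: DERIV_unique)
qed


subsection \<open>Pullback of forms to the normalization\<close>

lemma proj_pt_eq_range: "proj_pt v = range (\<lambda>k. k *s v)"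
  by (simp add: proj_pt_def vec.span_singleton)

lemma proj_pt_scale:
  assumes "k \<noteq> 0"
  shows "proj_pt (k *s v) = proj_pt v"
  unfolding proj_pt_eq_range
proof (intro equalityI subsetI)
  fix x assume "x \<in> range (\<lambda>l. l *s (k *s v))"
  then obtain l where "x = (l * k) *s v" by auto
  then show "x \<in> range (\<lambda>l. l *s v)" by blast
next
  fix x assume "x \<in> range (\<lambda>l. l *s v)"
  then obtain l where "x = (l / k) *s (k *s v)" using assms by auto
  then show "x \<in> range (\<lambda>l. l *s (k *s v))" by blast
qed

lemma proj_pt_eqE:
  assumes "proj_pt v = proj_pt w" "v \<noteq> 0"
  obtains k where "k \<noteq> 0" "v = k *s w"
proof -
  have "1 *s v \<in> proj_pt v" unfolding proj_pt_eq_range by (rule rangeI)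
  then have "1 *s v \<in> proj_pt w" by (simp only: assms(1))
  then obtain k where "v = k *s w" unfolding proj_pt_eq_range by auto
  with that assms(2) show ?thesis by (metis vector_smult_lzero)
qed

lemma form3_zero_scale: "form3 d c \<Longrightarrow> k \<noteq> 0 \<Longrightarrow> c (k *s v) = 0 \<longleftrightarrow> c v = 0"
  by (simp add: form3_scale)

lemma plane_curve_proj_pt:
  assumes "form3 d c" "d > 0" "v \<noteq> 0"
  shows "proj_pt v \<in> plane_curve c \<longleftrightarrow> c v = 0"
proof -
  have "v = 1 *s v" by simp
  then have "v \<in> proj_pt v" unfolding proj_pt_eq_range by blast
  then show ?thesis
    using assms unfolding plane_curve_def CP2_def
    by (auto simp: proj_pt_eq_range form3_scale)
qed

section \<open>The torus group on complex representatives\<close>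

context period_lattice
begin

lemma complex_lattice_lattice: "complex_lattice lattice"
  unfolding complex_lattice_def lattice_def using nondegenerate by blast

lemma torus_pt_eq: "torus_pt lattice z = (\<lambda>l. l + z) ` lattice"
  by (auto simp: torus_pt_def r_coset_def complex_add_group_def)

lemma in_torus_pt: "z \<in> torus_pt lattice z"
  using lattice_0 by (force simp: torus_pt_eq)

lemma torus_pt_eq_iff: "torus_pt lattice z = torus_pt lattice w \<longleftrightarrow> z - w \<in> lattice"
proof
  assume "torus_pt lattice z = torus_pt lattice w"
  then have "z \<in> torus_pt lattice w" using in_torus_pt by blast
  then show "z - w \<in> lattice" by (auto simp: torus_pt_eq)
next
  assume d: "z - w \<in> lattice"
  have "l + z \<in> (\<lambda>l. l + w) ` lattice" if "l \<in> lattice" for l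
    using lattice_add[OF that d] by (intro image_eqI[of _ _ "l + (z - w)"]) auto
  moreover have "l + w \<in> (\<lambda>l. l + z) ` lattice" if "l \<in> lattice" for l
    using lattice_diff[OF that d] by (intro image_eqI[of _ _ "l - (z - w)"]) auto
  ultimately show "torus_pt lattice z = torus_pt lattice w" by (auto simp: torus_pt_eq)
qed

lemma in_torus_pt_iff: "w \<in> torus_pt lattice z \<longleftrightarrow> w - z \<in> lattice"
  using torus_pt_eq_iff[of w z] in_torus_pt by (auto simp: torus_pt_eq)

lemma carrier_torus: "carrier (torus lattice) = range (torus_pt lattice)"
  by (auto simp: torus_def FactGroup_def RCOSETS_def torus_pt_def complex_add_group_def)

lemma torus_mult: "torus_pt lattice z \<otimes>\<^bsub>torus lattice\<^esub> torus_pt lattice w = torus_pt lattice (z + w)"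
proof -
  have "torus_pt lattice z \<otimes>\<^bsub>torus lattice\<^esub> torus_pt lattice w =
      (\<Union>x\<in>torus_pt lattice z. \<Union>y\<in>torus_pt lattice w. {x + y})"
    by (auto simp: torus_def FactGroup_def set_mult_def complex_add_group_def)
  also have "\<dots> = torus_pt lattice (z + w)"
  proof (intro equalityI subsetI)
    fix u assume "u \<in> (\<Union>x\<in>torus_pt lattice z. \<Union>y\<in>torus_pt lattice w. {x + y})"
    then obtain x y where "x - z \<in> lattice" "y - w \<in> lattice" "u = x + y"
      by (auto simp: in_torus_pt_iff)
    then show "u \<in> torus_pt lattice (z + w)"
      using lattice_add[of "x - z" "y - w"] by (simp add: in_torus_pt_iff algebra_simps)
  next
    fix u assume "u \<in> torus_pt lattice (z + w)"
    then have "u - w \<in> torus_pt lattice z" by (simp add: in_torus_pt_iff algebra_simps)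
    then show "u \<in> (\<Union>x\<in>torus_pt lattice z. \<Union>y\<in>torus_pt lattice w. {x + y})"
      using in_torus_pt[of w] by force
  qed
  finally show ?thesis .
qed

lemma torus_inv: "inv\<^bsub>torus lattice\<^esub> torus_pt lattice z = torus_pt lattice (- z)"
proof -
  interpret T: comm_group "torus lattice" by (rule comm_group_torus[OF complex_lattice_lattice])
  have "\<one>\<^bsub>torus lattice\<^esub> = torus_pt lattice 0"
    by (simp add: torus_def FactGroup_def torus_pt_eq)
  then show ?thesis
    by (intro T.inv_equality) (auto simp: torus_mult carrier_torus)
qed

lemma bij_betw_torus_pt: "bij_betw (torus_pt lattice) (parallelogram a) (carrier (torus lattice))"
  unfolding bij_betw_def
proof
  show "inj_on (torus_pt lattice) (parallelogram a)"
    using parallelogram_inject by (auto simp: inj_on_def torus_pt_eq_iff)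
  have "torus_pt lattice z = torus_pt lattice (reduce a z)" for z
    by (simp add: torus_pt_eq_iff reduce_diff)
  then show "torus_pt lattice ` parallelogram a = carrier (torus lattice)"
    unfolding carrier_torus using reduce_in by (metis (no_types, lifting) image_subset_iff image_eqI rangeI subsetI subset_antisym rangeE)
qed

lemma periodic_torus_pt: "periodic (torus_pt lattice)"
  by (simp add: periodic_def torus_pt_eq_iff lattice_omega)

end

section \<open>Forms along the curve and the lines through the center\<close>

locale binodal_chart = period_lattice \<omega>1 \<omega>2 for \<omega>1 \<omega>2 +
  fixes F :: "complex ^ 3 \<Rightarrow> complex" and T1 T2 :: "(complex ^ 3) set"
    and \<pi> :: "complex set \<Rightarrow> (complex ^ 3) set" and \<alpha> \<beta> :: complex
  assumes quartic: "nondegenerate_binodal_quartic F T1 T2"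
    and normalization: "elliptic_normalization lattice \<pi> F T1 T2"
    and center_off_curve: "F (vector [\<alpha>, \<beta>, 1]) \<noteq> 0"
begin

abbreviation "center \<equiv> vector [\<alpha>, \<beta>, 1] :: complex ^ 3"

text \<open>The lines through the center are \<open>t = \<mu> s\<close> for the two linear forms \<open>s\<close> and \<open>t\<close>;
  \<open>pencil \<mu> u\<close> is the point of such a line with \<open>s = 1\<close> and third coordinate \<open>u\<close>.\<close>

definition "s v = v $ 1 - \<alpha> * v $ 3" for v :: "complex ^ 3"

definition "t v = v $ 2 - \<beta> * v $ 3" for v :: "complex ^ 3"

definition pencil :: "complex \<Rightarrow> complex \<Rightarrow> complex ^ 3" where
  "pencil \<mu> u = vector [1, \<mu>, 0] + u *s center"

lemma pencil_nth: "pencil \<mu> u $ 1 = 1 + u * \<alpha>" "pencil \<mu> u $ 2 = \<mu> + u * \<beta>" "pencil \<mu> u $ 3 = u"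
  by (simp_all add: pencil_def)

lemma s_pencil: "s (pencil \<mu> u) = 1" and t_pencil: "t (pencil \<mu> u) = \<mu>"
  by (simp_all add: s_def t_def pencil_nth)

lemma pencil_nonzero: "pencil \<mu> u \<noteq> 0"
  using s_pencil[of \<mu> u] by (auto simp: s_def)

lemma form3_st: "form3 1 (\<lambda>v. a * s v + b * t v)"
  by (auto simp: form3_def s_def t_def algebra_simps intro!: poly3_intros)

lemma form3_s: "form3 1 s" and form3_t: "form3 1 t"
  using form3_st[of 1 0] form3_st[of 0 1] by simp_all

lemma form3_F: "form3 4 F"
  using quartic unfolding nondegenerate_binodal_quartic_def by (auto intro: ternary_form_imp_form3)

text \<open>An arbitrary choice with no continuity in \<open>z\<close>; only statements that are
  invariant under scaling are drawn from it. It depends on the torus point alone and is therefore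
  periodic.\<close>

definition rep :: "complex \<Rightarrow> complex ^ 3" where
  "rep z = (SOME v. v \<noteq> 0 \<and> \<pi> (torus_pt lattice z) = proj_pt v)"

lemma ex_local_lift: "\<exists>\<phi>. local_lift lattice \<pi> z \<phi>"
  using normalization by (auto simp: elliptic_normalization_def holomorphic_to_CP2_def)

lemma rep: "rep z \<noteq> 0" "\<pi> (torus_pt lattice z) = proj_pt (rep z)"
proof -
  obtain \<phi> where "local_lift lattice \<pi> z \<phi>" using ex_local_lift by blast
  then have "\<phi> z \<noteq> 0 \<and> \<pi> (torus_pt lattice z) = proj_pt (\<phi> z)"
    by (auto simp: local_lift_def)
  then show "rep z \<noteq> 0" "\<pi> (torus_pt lattice z) = proj_pt (rep z)"
    unfolding rep_def by (metis (mono_tags, lifting) someI_ex)+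
qed

lemma periodic_rep: "periodic rep"
  using periodic_torus_pt by (simp add: periodic_def rep_def)

lemma local_lift_ball:
  assumes "local_lift lattice \<pi> z \<phi>"
  shows "\<exists>r>0. (\<forall>i. (\<lambda>w. \<phi> w $ i) holomorphic_on ball z r) \<and>
    (\<forall>w\<in>ball z r. \<phi> w \<noteq> 0 \<and> (\<exists>k. k \<noteq> 0 \<and> \<phi> w = k *s rep w))"
proof -
  obtain r where r: "r > 0" "\<forall>i. (\<lambda>w. \<phi> w $ i) holomorphic_on ball z r"
    "\<forall>w\<in>ball z r. \<phi> w \<noteq> 0 \<and> \<pi> (torus_pt lattice w) = proj_pt (\<phi> w)"
    using assms unfolding local_lift_def by blast
  have "\<exists>k. k \<noteq> 0 \<and> \<phi> w = k *s rep w" if "w \<in> ball z r" for w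
    using r(3) that rep(2)[of w] by (metis proj_pt_eqE)
  with r show ?thesis by blast
qed

lemma local_lift_zero_iff:
  assumes "local_lift lattice \<pi> z \<phi>" "form3 d c"
  shows "eventually (\<lambda>w. c (\<phi> w) = 0 \<longleftrightarrow> c (rep w) = 0) (nhds z)"
    and "c (\<phi> z) = 0 \<longleftrightarrow> c (rep z) = 0"
    and "(\<lambda>w. c (\<phi> w)) analytic_on {z}"
proof -
  obtain r where r: "r > 0" "\<forall>i. (\<lambda>w. \<phi> w $ i) holomorphic_on ball z r"
    "\<forall>w\<in>ball z r. \<phi> w \<noteq> 0 \<and> (\<exists>k. k \<noteq> 0 \<and> \<phi> w = k *s rep w)"
    using local_lift_ball[OF assms(1)] by blast
  have "eventually (\<lambda>w. w \<in> ball z r) (nhds z)"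
    using r(1) by (intro eventually_nhds_in_open) auto
  then show *: "eventually (\<lambda>w. c (\<phi> w) = 0 \<longleftrightarrow> c (rep w) = 0) (nhds z)"
  proof eventually_elim
    case (elim w)
    then obtain k where "k \<noteq> 0" "\<phi> w = k *s rep w" using r(3) by blast
    then show ?case using form3_zero_scale[OF assms(2)] by simp
  qed
  show "c (\<phi> z) = 0 \<longleftrightarrow> c (rep z) = 0"
    using * by (rule eventually_nhds_x_imp_x)
  have "(\<lambda>w. c (\<phi> w)) holomorphic_on ball z r"
    by (rule poly3_holomorphic[OF form3_poly3[OF assms(2)]]) (use r(2) in blast)
  then show "(\<lambda>w. c (\<phi> w)) analytic_on {z}"
    using r(1) by (intro holomorphic_on_imp_analytic_at[of _ "ball z r"]) auto
qed

text \<open>This is the identity theorem for a form on the curve. The function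
  \<open>c (rep z)\<close> need not be meromorphic, since \<open>rep\<close> is scaled arbitrarily,
  but the indicator of its nonvanishing is: around each point a holomorphic lift makes it constant
  on a punctured neighborhood. The meromorphic dichotomy on the connected plane then applies to the
  indicator.\<close>

lemma form_dichotomy:
  assumes c: "form3 d c"
  shows "(\<forall>z. c (rep z) = 0) \<or> eventually (\<lambda>z. c (rep z) \<noteq> 0) (cosparse UNIV)"
proof -
  define ind where "ind z = (if c (rep z) = 0 then 0 else 1 :: complex)" for z
  have near: "eventually (\<lambda>w. c (rep w) = 0) (at z) \<or> eventually (\<lambda>w. c (rep w) \<noteq> 0) (at z)" for z
  proof -
    obtain \<phi> where lift: "local_lift lattice \<pi> z \<phi>" using ex_local_lift by blast
    note L = local_lift_zero_iff[OF lift c]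
    have ev: "eventually (\<lambda>w. c (\<phi> w) = 0 \<longleftrightarrow> c (rep w) = 0) (at z)"
      using L(1) by (simp add: eventually_nhds_conv_at)
    have iso: "isolated_singularity_at (\<lambda>w. c (\<phi> w)) z" "not_essential (\<lambda>w. c (\<phi> w)) z"
      using L(3) by (simp_all add: isolated_singularity_at_analytic not_essential_analytic)
    have "eventually (\<lambda>w. c (\<phi> w) = 0) (at z) \<or> eventually (\<lambda>w. c (\<phi> w) \<noteq> 0) (at z)"
      using not_essential_frequently_0_imp_eventually_0[OF iso] by (auto simp: frequently_def)
    then show ?thesis
    proof
      assume "eventually (\<lambda>w. c (\<phi> w) = 0) (at z)"
      with ev have "eventually (\<lambda>w. c (rep w) = 0) (at z)" by eventually_elim auto
      then show ?thesis ..
    next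
      assume "eventually (\<lambda>w. c (\<phi> w) \<noteq> 0) (at z)"
      with ev have "eventually (\<lambda>w. c (rep w) \<noteq> 0) (at z)" by eventually_elim auto
      then show ?thesis ..
    qed
  qed
  have "ind meromorphic_on {z}" for z
    using near[of z]
  proof
    assume "eventually (\<lambda>w. c (rep w) = 0) (at z)"
    then have "eventually (\<lambda>w. ind w = 0) (at z)" by eventually_elim (simp add: ind_def)
    then show ?thesis by (subst meromorphic_on_cong[where g = "\<lambda>_. 0"]) auto
  next
    assume "eventually (\<lambda>w. c (rep w) \<noteq> 0) (at z)"
    then have "eventually (\<lambda>w. ind w = 1) (at z)" by eventually_elim (simp add: ind_def)
    then show ?thesis by (subst meromorphic_on_cong[where g = "\<lambda>_. 1"]) auto
  qed
  then have "ind meromorphic_on UNIV" by (subst meromorphic_on_meromorphic_at) simp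
  then have "eventually (\<lambda>z. ind z = 0) (cosparse UNIV) \<or> eventually (\<lambda>z. ind z \<noteq> 0) (cosparse UNIV)"
    by (intro meromorphic_imp_constant_or_avoid) auto
  then show ?thesis
  proof
    assume *: "eventually (\<lambda>z. ind z = 0) (cosparse UNIV)"
    \<comment> \<open>Vanishing off a sparse set extends to every point by continuity of a lift
      there.\<close>
    have "c (rep z) = 0" for z
    proof -
      obtain \<phi> where lift: "local_lift lattice \<pi> z \<phi>" using ex_local_lift by blast
      note L = local_lift_zero_iff[OF lift c]
      have "eventually (\<lambda>w. ind w = 0) (at z)" using * by (simp add: eventually_cosparse_open_eq)
      moreover have "eventually (\<lambda>w. c (\<phi> w) = 0 \<longleftrightarrow> c (rep w) = 0) (at z)"
        using L(1) by (simp add: eventually_nhds_conv_at)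
      ultimately have "eventually (\<lambda>w. c (\<phi> w) = 0) (at z)"
        by eventually_elim (simp add: ind_def split: if_splits)
      then have "(\<lambda>w. c (\<phi> w)) \<midarrow>z\<rightarrow> 0" by (rule tendsto_eventually)
      moreover have "(\<lambda>w. c (\<phi> w)) \<midarrow>z\<rightarrow> c (\<phi> z)"
        using analytic_at_imp_isCont[OF L(3)] by (simp add: isCont_def)
      ultimately show ?thesis using L(2) LIM_unique by blast
    qed
    then show ?thesis by blast
  next
    assume "eventually (\<lambda>z. ind z \<noteq> 0) (cosparse UNIV)"
    then have "eventually (\<lambda>z. c (rep z) \<noteq> 0) (cosparse UNIV)"
      by eventually_elim (simp add: ind_def split: if_splits)
    then show ?thesis ..
  qed
qed

lemma plane_curve_F: "\<pi> ` carrier (torus lattice) = plane_curve F"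
  using normalization by (simp add: elliptic_normalization_def)

lemma F_rep: "F (rep z) = 0"
proof -
  have "torus_pt lattice z \<in> carrier (torus lattice)" by (simp add: carrier_torus)
  then have "\<pi> (torus_pt lattice z) \<in> plane_curve F" unfolding plane_curve_F[symmetric] by (rule imageI)
  then have "proj_pt (rep z) \<in> plane_curve F" by (simp only: rep(2))
  then show ?thesis using plane_curve_proj_pt[OF form3_F _ rep(1)] by simp
qed

lemma curve_point:
  assumes "v \<noteq> 0" "F v = 0"
  shows "\<exists>z\<in>parallelogram 0. \<exists>k. k \<noteq> 0 \<and> rep z = k *s v"
proof -
  have "proj_pt v \<in> \<pi> ` carrier (torus lattice)"
    using plane_curve_proj_pt[OF form3_F _ assms(1)] assms(2) unfolding plane_curve_F by simp
  then obtain x where x: "x \<in> carrier (torus lattice)" "proj_pt v = \<pi> x" by blast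
  then obtain z where "z \<in> parallelogram 0" "x = torus_pt lattice z"
    unfolding bij_betw_imp_surj_on[OF bij_betw_torus_pt[of 0], symmetric] by blast
  then have "z \<in> parallelogram 0" "proj_pt (rep z) = proj_pt v"
    using x(2) rep(2) by auto
  then show ?thesis using rep(1) by (metis proj_pt_eqE)
qed

text \<open>The center is the only projective point at which both linear forms vanish.\<close>

lemma center_avoid: "s (rep z) = 0 \<Longrightarrow> t (rep z) \<noteq> 0"
proof
  assume "s (rep z) = 0" "t (rep z) = 0"
  then have eq: "rep z = rep z $ 3 *s center"
    by (simp add: vec_eq_iff forall_3 s_def t_def)
  then have "rep z $ 3 \<noteq> 0" using rep(1)[of z] by auto
  moreover have "F (rep z $ 3 *s center) = 0" using F_rep[of z] eq by simp
  ultimately show False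
    using form3_zero_scale[OF form3_F] center_off_curve by blast
qed

lemma line_poly: "\<exists>p. degree p = 4 \<and> (\<forall>u. poly p u = F (pencil \<mu> u))"
proof -
  have "ternary_form 4 F" using quartic by (simp add: nondegenerate_binodal_quartic_def)
  from ternary_form_line[OF this, of center "vector [1, \<mu>, 0]"]
  obtain p where "degree p \<le> 4" "coeff p 4 = F center" "\<forall>u. poly p u = F (pencil \<mu> u)"
    unfolding pencil_def by blast
  then show ?thesis using center_off_curve by (metis le_antisym le_degree)
qed

lemma ex_curve_point:
  "\<exists>z\<in>parallelogram 0. \<exists>u. rep z = s (rep z) *s pencil \<mu> u \<and> s (rep z) \<noteq> 0"
proof -
  obtain p where p: "degree p = 4" "\<forall>u. poly p u = F (pencil \<mu> u)" using line_poly by blast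
  then obtain u where "F (pencil \<mu> u) = 0" using Fundamental_Theorem_Algebra.fundamental_theorem_of_algebra[of p]
    by (auto simp: Fundamental_Theorem_Algebra.constant_degree)
  then obtain z k where z: "z \<in> parallelogram 0" "k \<noteq> 0" "rep z = k *s pencil \<mu> u"
    using curve_point[OF pencil_nonzero] by blast
  then have "s (rep z) = k" using form3_scale[OF form3_s] s_pencil by simp
  then show ?thesis using z by metis
qed

text \<open>The line of slope \<open>\<mu> + 1\<close> contains a curve point with \<open>s\<close>
  nonzero, and there \<open>t - \<mu> * s\<close> equals \<open>s\<close>. So this form does not
  vanish on the whole curve.\<close>

lemma eventually_avoid: "eventually (\<lambda>z. t (rep z) \<noteq> \<mu> * s (rep z)) (cosparse UNIV)"
proof -
  define c where "c v = (- \<mu>) * s v + 1 * t v" for v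
  have c: "form3 1 c" unfolding c_def[abs_def] by (rule form3_st)
  obtain z u where "rep z = s (rep z) *s pencil (\<mu> + 1) u" "s (rep z) \<noteq> 0" using ex_curve_point[of "\<mu> + 1"] by blast
  then have "c (rep z) \<noteq> 0"
    using form3_zero_scale[OF c, of "s (rep z)" "pencil (\<mu> + 1) u"] by (simp add: c_def s_pencil t_pencil)
  then show ?thesis using form_dichotomy[OF c] by (auto simp: c_def)
qed

lemma eventually_s: "eventually (\<lambda>z. s (rep z) \<noteq> 0) (cosparse UNIV)"
proof -
  obtain z u where "s (rep z) \<noteq> 0" using ex_curve_point by blast
  then show ?thesis using form_dichotomy[OF form3_s] by blast
qed


section \<open>The affine chart and the orders of forms\<close>

abbreviation nonvanishing :: "(complex ^ 3 \<Rightarrow> complex) \<Rightarrow> bool" where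
  "nonvanishing c \<equiv> eventually (\<lambda>z. c (rep z) \<noteq> 0) (cosparse UNIV)"

lemma nonvanishing_at: "nonvanishing c \<Longrightarrow> eventually (\<lambda>w. c (rep w) \<noteq> 0) (at z)"
  by (simp add: eventually_cosparse_open_eq)

text \<open>Division by \<open>s\<close> cancels the arbitrary scaling of \<open>rep\<close>, so the
  local lifts glue to one global map with periodic meromorphic coordinates. Where \<open>s\<close>
  vanishes the value is 0, by division by zero.\<close>

definition \<psi> :: "complex \<Rightarrow> complex ^ 3" where
  "\<psi> z = (1 / s (rep z)) *s rep z"

lemma periodic_comp_\<psi>: "periodic (\<lambda>z. g (\<psi> z))"
  using periodic_rep by (simp add: periodic_def \<psi>_def)

lemma form_\<psi>: "form3 d c \<Longrightarrow> c (\<psi> z) = c (rep z) / s (rep z) ^ d"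
  by (simp add: \<psi>_def form3_scale power_divide)

lemma s_\<psi>: "s (rep z) \<noteq> 0 \<Longrightarrow> s (\<psi> z) = 1"
  using form_\<psi>[OF form3_s] by simp

lemma F_\<psi>: "F (\<psi> z) = 0"
  using form_\<psi>[OF form3_F] F_rep by simp

lemma \<psi>_lift:
  assumes "local_lift lattice \<pi> z \<phi>"
  shows "eventually (\<lambda>w. \<psi> w = (1 / s (\<phi> w)) *s \<phi> w) (nhds z)"
proof -
  obtain r where r: "r > 0"
    "\<forall>w\<in>ball z r. \<phi> w \<noteq> 0 \<and> (\<exists>k. k \<noteq> 0 \<and> \<phi> w = k *s rep w)"
    using local_lift_ball[OF assms(1)] by blast
  have "eventually (\<lambda>w. w \<in> ball z r) (nhds z)"
    using r(1) by (intro eventually_nhds_in_open) auto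
  then show ?thesis
  proof eventually_elim
    case (elim w)
    then obtain k where "k \<noteq> 0" "\<phi> w = k *s rep w" using r(2) by blast
    then show ?case using form3_scale[OF form3_s] by (simp add: \<psi>_def)
  qed
qed

lemma \<psi>_coord_lift:
  assumes "local_lift lattice \<pi> z \<phi>"
  shows "eventually (\<lambda>w. \<psi> w $ i = \<phi> w $ i / s (\<phi> w)) (nhds z)"
  using \<psi>_lift[OF assms] by eventually_elim simp

lemma \<psi>_meromorphic: "(\<lambda>z. \<psi> z $ i) meromorphic_on A"
proof -
  have "(\<lambda>z. \<psi> z $ i) meromorphic_on {z}" for z
  proof -
    obtain \<phi> where lift: "local_lift lattice \<pi> z \<phi>" using ex_local_lift by blast
    have "(\<lambda>w. \<phi> w $ i / s (\<phi> w)) meromorphic_on {z}"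
      using local_lift_zero_iff(3)[OF lift form3_coord] local_lift_zero_iff(3)[OF lift form3_s]
      by (intro meromorphic_intros analytic_on_imp_meromorphic_on)
    moreover have "eventually (\<lambda>w. \<psi> w $ i = \<phi> w $ i / s (\<phi> w)) (at z)"
      using \<psi>_coord_lift[OF lift] by (simp add: eventually_nhds_conv_at)
    ultimately show ?thesis by (subst meromorphic_on_cong) auto
  qed
  then show ?thesis by (subst meromorphic_on_meromorphic_at) auto
qed

lemma \<psi>_analytic:
  assumes "s (rep z) \<noteq> 0"
  shows "(\<lambda>w. \<psi> w $ i) analytic_on {z}"
proof -
  obtain \<phi> where lift: "local_lift lattice \<pi> z \<phi>" using ex_local_lift by blast
  have "(\<lambda>w. \<phi> w $ i / s (\<phi> w)) analytic_on {z}"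
    using local_lift_zero_iff[OF lift form3_coord] local_lift_zero_iff[OF lift form3_s] assms
    by (intro analytic_on_divide) auto
  then show ?thesis
    using analytic_at_cong[OF \<psi>_coord_lift[OF lift, of i] refl] by simp
qed

lemma form_\<psi>_meromorphic: "poly3 c \<Longrightarrow> (\<lambda>z. c (\<psi> z)) meromorphic_on A"
  by (rule poly3_meromorphic[OF _ \<psi>_meromorphic])

lemma nonvanishing_\<psi>:
  assumes "form3 d c" "nonvanishing c"
  shows "eventually (\<lambda>z. c (\<psi> z) \<noteq> 0) (cosparse UNIV)"
  using assms(2) eventually_s by eventually_elim (simp add: form_\<psi>[OF assms(1)])

text \<open>By homogeneity \<open>c (\<phi> w) = c (\<psi> w) * s (\<phi> w) ^ d\<close> near
  \<open>z\<close>, which splits off the part of the order that is common to all forms of degree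
  \<open>d\<close>.\<close>

lemma zorder_lift:
  assumes lift: "local_lift lattice \<pi> z \<phi>" and c: "form3 d c" "nonvanishing c"
  shows "zorder (\<lambda>w. c (\<phi> w)) z = zorder (\<lambda>w. c (\<psi> w)) z + int d * zorder (\<lambda>w. s (\<phi> w)) z"
proof -
  have s_ev: "eventually (\<lambda>w. s (\<phi> w) \<noteq> 0) (at z)"
    using local_lift_zero_iff(1)[OF lift form3_s, unfolded eventually_nhds_conv_at, THEN conjunct1]
      nonvanishing_at[OF eventually_s, of z] by eventually_elim simp
  then have s_pow_ev: "eventually (\<lambda>w. s (\<phi> w) ^ d \<noteq> 0) (at z)" by eventually_elim simp
  have c_ev: "eventually (\<lambda>w. c (\<psi> w) \<noteq> 0) (at z)"
    using nonvanishing_\<psi>[OF c] by (simp add: eventually_cosparse_open_eq)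
  have s_mero: "(\<lambda>w. s (\<phi> w)) meromorphic_on {z}"
    by (intro analytic_on_imp_meromorphic_on local_lift_zero_iff(3)[OF lift form3_s])
  have "eventually (\<lambda>w. \<psi> w = (1 / s (\<phi> w)) *s \<phi> w) (at z)"
    using \<psi>_lift[OF lift] by (simp add: eventually_nhds_conv_at)
  with s_ev have "eventually (\<lambda>w. c (\<phi> w) = c (\<psi> w) * s (\<phi> w) ^ d) (at z)"
    by eventually_elim (simp add: form3_scale[OF c(1)] power_divide)
  then have "zorder (\<lambda>w. c (\<phi> w)) z = zorder (\<lambda>w. c (\<psi> w) * s (\<phi> w) ^ d) z"
    by (intro zorder_cong) auto
  also have "\<dots> = zorder (\<lambda>w. c (\<psi> w)) z + zorder (\<lambda>w. s (\<phi> w) ^ d) z"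
    using c_ev s_pow_ev
    by (intro zorder_mult form_\<psi>_meromorphic form3_poly3[OF c(1)] meromorphic_on_power s_mero
        eventually_frequently) auto
  also have "zorder (\<lambda>w. s (\<phi> w) ^ d) z = int d * zorder (\<lambda>w. s (\<phi> w)) z"
    using s_ev by (intro zorder_power s_mero eventually_frequently) auto
  finally show ?thesis .
qed

text \<open>Some coordinate of a local lift does not vanish at \<open>z\<close>, and this coordinate of \<open>\<psi>\<close> has
  its order at \<open>z\<close> from the denominator \<open>s\<close> alone.\<close>

definition s_order :: "complex \<Rightarrow> int" where
  "s_order z = - zorder (\<lambda>w. \<psi> w $ (SOME i. rep z $ i \<noteq> 0)) z"

lemma form_nonvanishingI: "form3 d c \<Longrightarrow> c (rep z) \<noteq> 0 \<Longrightarrow> nonvanishing c"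
  using form_dichotomy by blast

lemma zorder_lift_nonneg:
  assumes lift: "local_lift lattice \<pi> z \<phi>" and c: "form3 d c" "nonvanishing c"
  shows "zorder (\<lambda>w. c (\<phi> w)) z \<ge> 0" "zorder (\<lambda>w. c (\<phi> w)) z > 0 \<longleftrightarrow> c (rep z) = 0"
proof -
  note L = local_lift_zero_iff[OF lift c(1)]
  have "eventually (\<lambda>w. c (\<phi> w) \<noteq> 0) (at z)"
    using L(1)[unfolded eventually_nhds_conv_at, THEN conjunct1] nonvanishing_at[OF c(2), of z]
    by eventually_elim simp
  then have fr: "frequently (\<lambda>w. c (\<phi> w) \<noteq> 0) (at z)" by (simp add: eventually_frequently)
  show "zorder (\<lambda>w. c (\<phi> w)) z \<ge> 0" by (rule zorder_ge_0[OF L(3) fr])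
  show "zorder (\<lambda>w. c (\<phi> w)) z > 0 \<longleftrightarrow> c (rep z) = 0"
    using zorder_pos_iff'[OF L(3) fr] L(2) by simp
qed

text \<open>The selected coordinate of the lift has order 0 at \<open>z\<close>, so its order in the
  chart is minus that of \<open>s\<close>. In particular the order of \<open>s\<close> is the same
  for every lift.\<close>

lemma s_order_lift:
  assumes lift: "local_lift lattice \<pi> z \<phi>"
  shows "zorder (\<lambda>w. s (\<phi> w)) z = s_order z"
proof -
  define i where "i = (SOME i. rep z $ i \<noteq> 0)"
  have "\<exists>i. rep z $ i \<noteq> 0" using rep(1)[of z] by (auto simp: vec_eq_iff)
  then have i: "rep z $ i \<noteq> 0" unfolding i_def by (rule someI_ex)
  have nv: "nonvanishing (\<lambda>v. v $ i)" by (rule form_nonvanishingI[OF form3_coord i])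
  have "zorder (\<lambda>w. \<phi> w $ i) z = 0"
    using zorder_lift_nonneg[OF lift form3_coord nv] i by simp
  then show ?thesis
    using zorder_lift[OF lift form3_coord nv] by (simp add: s_order_def i_def)
qed

text \<open>The multiplicity of the pullback divisor, expressed without a lift so that its
  periodicity is visible.\<close>

definition form_order :: "(complex ^ 3 \<Rightarrow> complex) \<Rightarrow> nat \<Rightarrow> complex \<Rightarrow> int" where
  "form_order c d z = zorder (\<lambda>w. c (\<psi> w)) z + int d * s_order z"

lemma form_order_lift:
  assumes "local_lift lattice \<pi> z \<phi>" "form3 d c" "nonvanishing c"
  shows "zorder (\<lambda>w. c (\<phi> w)) z = form_order c d z"
  using zorder_lift[OF assms] s_order_lift[OF assms(1)] by (simp add: form_order_def)

lemma form_order_nonneg: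
  assumes "form3 d c" "nonvanishing c"
  shows "form_order c d z \<ge> 0" "form_order c d z > 0 \<longleftrightarrow> c (rep z) = 0" "form_order c d z = 0 \<longleftrightarrow> c (rep z) \<noteq> 0"
proof -
  obtain \<phi> where lift: "local_lift lattice \<pi> z \<phi>" using ex_local_lift by blast
  show *: "form_order c d z \<ge> 0" "form_order c d z > 0 \<longleftrightarrow> c (rep z) = 0"
    using zorder_lift_nonneg[OF lift assms] by (simp_all add: form_order_lift[OF lift assms])
  then show "form_order c d z = 0 \<longleftrightarrow> c (rep z) \<noteq> 0" by auto
qed

lemma periodic_form_order: "periodic (form_order c d)"
proof -
  have "periodic (zorder (\<lambda>w. c (\<psi> w)))" for c
    by (rule periodic_zorder[OF periodic_comp_\<psi>])
  from this[of c] this[of "\<lambda>v. v $ i" for i] show ?thesis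
    using periodic_rep by (simp add: periodic_def form_order_def s_order_def)
qed

text \<open>The definite description is well defined: every lift gives \<open>form_order\<close>,
  and that is periodic, so neither the lift nor the representative matters.\<close>

lemma pullback_order_eq:
  assumes "form3 d c" "nonvanishing c"
  shows "pullback_order lattice \<pi> c (torus_pt lattice z) = form_order c d z"
  unfolding pullback_order_def
proof (rule the_equality)
  obtain \<phi> where "local_lift lattice \<pi> z \<phi>" using ex_local_lift by blast
  then show "\<exists>z'\<in>torus_pt lattice z. \<exists>\<phi>. local_lift lattice \<pi> z' \<phi> \<and> form_order c d z = zorder (\<lambda>w. c (\<phi> w)) z'"
    using form_order_lift[OF _ assms] in_torus_pt by metis
next
  fix n assume "\<exists>z'\<in>torus_pt lattice z. \<exists>\<phi>. local_lift lattice \<pi> z' \<phi> \<and> n = zorder (\<lambda>w. c (\<phi> w)) z'"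
  then obtain z' where z': "z' - z \<in> lattice" "n = form_order c d z'"
    using form_order_lift[OF _ assms] by (auto simp: in_torus_pt_iff)
  then show "n = form_order c d z"
    using periodic_lattice[OF periodic_form_order z'(1), of c d z] by simp
qed

lemma form_order_s: "form_order s 1 z = s_order z"
proof -
  have "eventually (\<lambda>w. s (\<psi> w) = 1) (at z)"
    using nonvanishing_at[OF eventually_s] by eventually_elim (rule s_\<psi>)
  then have "zorder (\<lambda>w. s (\<psi> w)) z = zorder (\<lambda>_. 1) z" by (intro zorder_cong) auto
  also have "\<dots> = 0" by (rule zorder_eq_0I) auto
  finally show ?thesis by (simp add: form_order_def)
qed

lemmas s_order_nonneg = form_order_nonneg[OF form3_s eventually_s, unfolded form_order_s]

definition zero_set :: "(complex ^ 3 \<Rightarrow> complex) \<Rightarrow> complex set" where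
  "zero_set c = {z \<in> parallelogram 0. c (rep z) = 0}"

lemma finite_zero_set: "nonvanishing c \<Longrightarrow> finite (zero_set c)"
  using finite_zeros_bounded[OF _ bounded_parallelogram, of "\<lambda>z. c (rep z) \<noteq> 0" 0]
  by (simp add: zero_set_def)

lemma form_order_sums:
  assumes c: "form3 d c" "nonvanishing c"
  shows "(\<Sum>z\<in>zero_set c. form_order c d z) = int d * (\<Sum>z\<in>zero_set s. s_order z)"
    and "(\<Sum>z\<in>zero_set c. of_int (form_order c d z) * z)
      - of_nat d * (\<Sum>z\<in>zero_set s. of_int (s_order z) * z) \<in> lattice"
proof -
  define g where "g = (\<lambda>z. c (\<psi> z))"
  \<comment> \<open>Zeros and poles of \<open>c\<close> on the chart occur only at zeros of
    \<open>c\<close> or of \<open>s\<close>. All three sums can therefore be taken over this one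
    set, the additional terms being 0.\<close>
  define W where "W = zero_set c \<union> zero_set s"
  have fin: "finite W" using finite_zero_set c(2) eventually_s by (simp add: W_def)
  note sums = divisor_sums[OF form_\<psi>_meromorphic[OF form3_poly3[OF c(1)]] periodic_comp_\<psi> nonvanishing_\<psi>[OF c],
      folded g_def]
  have sub: "{z \<in> parallelogram 0. zorder g z \<noteq> 0} \<subseteq> W"
  proof
    fix z assume z: "z \<in> {z \<in> parallelogram 0. zorder g z \<noteq> 0}"
    then have "form_order c d z \<noteq> 0 \<or> s_order z \<noteq> 0" by (auto simp: form_order_def g_def)
    then show "z \<in> W"
      using z form_order_nonneg(3)[OF c] s_order_nonneg(3) by (auto simp: W_def zero_set_def)
  qed
  have W_para: "W \<subseteq> parallelogram 0" by (auto simp: W_def zero_set_def)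
  have W_c: "sum h (zero_set c) = sum h W" if "\<And>z. form_order c d z = 0 \<Longrightarrow> h z = 0" for h :: "complex \<Rightarrow> 'b::comm_monoid_add"
    using fin W_para form_order_nonneg(3)[OF c] that
    by (intro sum.mono_neutral_left) (auto simp: W_def zero_set_def)
  have W_s: "sum h (zero_set s) = sum h W" if "\<And>z. s_order z = 0 \<Longrightarrow> h z = 0" for h :: "complex \<Rightarrow> 'b::comm_monoid_add"
    using fin W_para s_order_nonneg(3) that
    by (intro sum.mono_neutral_left) (auto simp: W_def zero_set_def)
  have W_g: "sum h {z \<in> parallelogram 0. zorder g z \<noteq> 0} = sum h W" if "\<And>z. zorder g z = 0 \<Longrightarrow> h z = 0" for h :: "complex \<Rightarrow> 'b::comm_monoid_add"
    using fin W_para sub that by (intro sum.mono_neutral_left) auto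
  have eq: "form_order c d z = zorder g z + int d * s_order z" for z by (simp add: form_order_def g_def)
  have "(\<Sum>z\<in>W. zorder g z) = 0" using sums(2) by (subst (asm) W_g) auto
  then show "(\<Sum>z\<in>zero_set c. form_order c d z) = int d * (\<Sum>z\<in>zero_set s. s_order z)"
    by (subst W_c, simp, subst W_s, simp) (simp add: eq sum.distrib sum_distrib_left)
  have "(\<Sum>z\<in>W. of_int (zorder g z) * z) \<in> lattice" using sums(3) by (subst (asm) W_g) auto
  moreover have "(\<Sum>z\<in>W. of_int (form_order c d z) * z) - of_nat d * (\<Sum>z\<in>W. of_int (s_order z) * z)
      = (\<Sum>z\<in>W. of_int (zorder g z) * z)"
    unfolding sum_distrib_left sum_subtractf[symmetric] by (intro sum.cong refl) (simp add: eq algebra_simps)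
  ultimately show "(\<Sum>z\<in>zero_set c. of_int (form_order c d z) * z)
      - of_nat d * (\<Sum>z\<in>zero_set s. of_int (s_order z) * z) \<in> lattice"
    by (subst W_c, simp, subst W_s, simp) simp
qed

end


subsection \<open>The degree of the normalization map\<close>

lemma eventually_at_cosparse: "eventually P (cosparse UNIV) \<Longrightarrow> eventually P (at z)" for z :: complex
  by (simp add: eventually_cosparse_open_eq)

lemma card_roots_rsquarefree:
  fixes p :: "complex poly"
  assumes "rsquarefree p"
  shows "card {z. poly p z = 0} = degree p"
proof -
  have "p \<noteq> 0" using assms by (simp add: rsquarefree_def)
  have "degree p = degree (smult (lead_coeff p) (\<Prod>z|poly p z = 0. [:- z, 1:]))"
    by (simp only: complex_poly_decompose_rsquarefree[OF assms])
  also have "\<dots> = (\<Sum>z|poly p z = 0. degree [:- z, 1:])"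
    using \<open>p \<noteq> 0\<close> by (simp only: degree_smult_eq leading_coeff_0_iff if_False, subst degree_prod_eq_sum_degree) auto
  finally show ?thesis by simp
qed

section \<open>Lines through the center in general position\<close>

context binodal_chart
begin

lemma t_\<psi>_meromorphic: "(\<lambda>w. t (\<psi> w)) meromorphic_on A"
  by (rule form_\<psi>_meromorphic[OF form3_poly3[OF form3_t]])

lemma poly3_\<psi>_analytic:
  assumes "poly3 c" "s (rep z) \<noteq> 0"
  shows "(\<lambda>w. c (\<psi> w)) analytic_on {z}"
  using assms(1) by (induction rule: poly3.induct) (auto intro!: analytic_intros \<psi>_analytic assms(2))

lemma t_\<psi>: "t (\<psi> z) = t (rep z) / s (rep z)"
  using form_\<psi>[OF form3_t] by simp

text \<open>Otherwise \<open>t\<close> would be constant along the chart on some disc, and the curve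
  would meet a line through the center in more than a sparse set.\<close>

lemma eventually_deriv_nonzero: "eventually (\<lambda>z. deriv (\<lambda>w. t (\<psi> w)) z \<noteq> 0) (cosparse UNIV)"
proof (rule ccontr)
  let ?g = "\<lambda>w. t (\<psi> w)"
  assume "\<not> ?thesis"
  moreover have "deriv ?g meromorphic_on UNIV"
    by (intro meromorphic_on_deriv t_\<psi>_meromorphic)
  ultimately have "eventually (\<lambda>z. deriv ?g z = 0) (cosparse UNIV)"
    using meromorphic_imp_constant_or_avoid[of "deriv ?g" UNIV 0] by auto
  with eventually_s have "eventually (\<lambda>z. s (rep z) \<noteq> 0 \<and> deriv ?g z = 0) (cosparse UNIV)"
    by eventually_elim simp
  then have "eventually (\<lambda>z. s (rep z) \<noteq> 0 \<and> deriv ?g z = 0) (at 0)"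
    by (rule eventually_at_cosparse)
  then obtain r where r: "r > 0" "\<And>z. z \<noteq> 0 \<Longrightarrow> norm z < r \<Longrightarrow> s (rep z) \<noteq> 0 \<and> deriv ?g z = 0"
    by (auto simp: eventually_at)
  \<comment> \<open>The vanishing is known only off 0. The disc of radius \<open>r / 2\<close>
    around \<open>r / 2\<close> is a convex part of the punctured disc of radius
    \<open>r\<close>.\<close>
  define z1 :: complex where "z1 = of_real (r / 2)"
  define B where "B = ball z1 (r / 2)"
  have z1: "z1 \<in> B" using r(1) by (simp add: B_def)
  have in_B: "z \<noteq> 0 \<and> norm z < r" if "z \<in> B" for z
  proof -
    have n1: "norm z1 = r / 2" using r(1) by (simp add: z1_def)
    have "norm (z - z1) < r / 2" using that by (simp add: B_def dist_norm norm_minus_commute)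
    then show ?thesis using norm_triangle_ineq[of "z - z1" z1] n1 by auto
  qed
  have "(?g has_field_derivative 0) (at z within B)" if "z \<in> B" for z
  proof -
    have z: "s (rep z) \<noteq> 0" "deriv ?g z = 0" using in_B[OF that] r(2) by auto
    have "?g field_differentiable at z"
      using poly3_\<psi>_analytic[OF form3_poly3[OF form3_t] z(1)] analytic_on_imp_differentiable_at by blast
    then show ?thesis
      using z(2) by (metis DERIV_deriv_iff_field_differentiable has_field_derivative_at_within)
  qed
  moreover have "convex B" by (simp add: B_def)
  ultimately obtain c where c: "\<And>z. z \<in> B \<Longrightarrow> ?g z = c"
    using has_field_derivative_zero_constant[of B ?g] by auto
  have "eventually (\<lambda>z. t (rep z) \<noteq> c * s (rep z)) (at z1)"
    by (intro eventually_at_cosparse eventually_avoid)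
  moreover have "eventually (\<lambda>z. z \<in> B) (at z1)"
    using z1 by (intro eventually_at_in_open') (auto simp: B_def)
  ultimately have "eventually (\<lambda>_. False) (at z1)"
  proof eventually_elim
    case (elim z)
    then have "t (rep z) / s (rep z) = c" "s (rep z) \<noteq> 0"
      using c[OF elim(2)] in_B[OF elim(2)] r(2) by (auto simp: t_\<psi>)
    then show False using elim(1) by (auto simp: field_simps)
  qed
  then show False by simp
qed

lemma eventually_ne_point:
  assumes "T \<in> CP2"
  shows "eventually (\<lambda>z. \<pi> (torus_pt lattice z) \<noteq> T) (cosparse UNIV)"
proof -
  obtain v where v: "T = proj_pt v" "v \<noteq> 0" using assms by (auto simp: CP2_def)
  show ?thesis
    \<comment> \<open>If \<open>s v\<close> is nonzero, this is the slope of the line through the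
      center and \<open>T\<close>. If \<open>s v = 0\<close>, the quotient is the default 0 and
      \<open>eventually_s\<close> alone excludes \<open>T\<close>.\<close>
    using eventually_s eventually_avoid[of "t v / s v"]
  proof eventually_elim
    case (elim z)
    show ?case
    proof
      assume "\<pi> (torus_pt lattice z) = T"
      then obtain k where "k \<noteq> 0" "rep z = k *s v"
        using v rep by (metis proj_pt_eqE)
      then show False
        using elim form3_scale[OF form3_s, of k v] form3_scale[OF form3_t, of k v] by auto
    qed
  qed
qed

lemma nodes: "singular_points F = {T1, T2}" "{T1, T2} \<subseteq> CP2"
proof -
  show *: "singular_points F = {T1, T2}"
    using quartic by (simp add: nondegenerate_binodal_quartic_def)
  show "{T1, T2} \<subseteq> CP2"
    unfolding *[symmetric] by (auto simp: singular_points_def plane_curve_def)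
qed

lemma singular_pointI:
  assumes G: "partials F G" and "v \<noteq> 0" "F v = 0" "\<And>i. G i v = 0"
  shows "proj_pt v \<in> singular_points F"
  unfolding singular_points_def
proof (intro CollectI conjI ballI)
  show "proj_pt v \<in> plane_curve F"
    using plane_curve_proj_pt[OF form3_F _ assms(2)] assms(3) by simp
  fix w assume "w \<in> proj_pt v - {0}"
  then obtain k where k: "w = k *s v" "k \<noteq> 0" by (auto simp: proj_pt_eq_range)
  have "G i w = 0" for i
    unfolding k(1) by (rule form3_partial_scale_zero[OF form3_F G assms(4) k(2)])
  then have "(\<chi> i. G i w) = 0" by (simp add: vec_eq_iff)
  then show "has_gradient F 0 w"
    using G unfolding partials_def by metis
qed

text \<open>If the derivative of \<open>F\<close> along the center vanished on the whole curve, then together with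
  Euler's relation and the tangency of \<open>\<psi>'\<close> the full gradient would vanish on it.\<close>

lemma eventually_transversal:
  assumes G: "partials F G"
  shows "eventually (\<lambda>z. (\<Sum>i\<in>UNIV. G i (\<psi> z) * center $ i) \<noteq> 0) (cosparse UNIV)"
proof (rule ccontr)
  let ?H = "\<lambda>v. \<Sum>i\<in>UNIV. G i v * center $ i"
  assume "\<not> ?thesis"
  moreover have "poly3 ?H"
    using G by (intro poly3_sum poly3.mult poly3.const) (auto simp: partials_def)
  ultimately have "eventually (\<lambda>z. ?H (\<psi> z) = 0) (cosparse UNIV)"
    using meromorphic_imp_constant_or_avoid[OF form_\<psi>_meromorphic, of ?H UNIV 0] by auto
  moreover have "eventually (\<lambda>z. \<pi> (torus_pt lattice z) \<notin> {T1, T2}) (cosparse UNIV)"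
    using eventually_ne_point[of T1] eventually_ne_point[of T2] nodes(2) by (auto elim: eventually_elim2)
  ultimately have "eventually (\<lambda>z. s (rep z) \<noteq> 0 \<and> deriv (\<lambda>w. t (\<psi> w)) z \<noteq> 0 \<and> ?H (\<psi> z) = 0 \<and>
      \<pi> (torus_pt lattice z) \<notin> {T1, T2}) (cosparse UNIV)"
    using eventually_s eventually_deriv_nonzero by eventually_elim simp
  from eventually_happens[OF this]
  obtain z where z: "s (rep z) \<noteq> 0" "deriv (\<lambda>w. t (\<psi> w)) z \<noteq> 0" "?H (\<psi> z) = 0"
    "\<pi> (torus_pt lattice z) \<notin> {T1, T2}"
    by auto
  define d where "d i = deriv (\<lambda>w. \<psi> w $ i) z" for i
  define g where "g i = G i (\<psi> z)" for i
  have d: "((\<lambda>w. \<psi> w $ i) has_field_derivative d i) (at z)" for i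
    unfolding d_def using \<psi>_analytic[OF z(1), of i] analytic_on_imp_differentiable_at
    by (intro field_differentiable_derivI) blast
  have "eventually (\<lambda>w. s (rep w) \<noteq> 0) (nhds z)"
    using z(1) nonvanishing_at[OF eventually_s, of z] by (simp add: eventually_nhds_conv_at)
  \<comment> \<open>The chart lies in the plane \<open>s = 1\<close>, so its velocity is annihilated
    by \<open>s\<close>.\<close>
  then have "eventually (\<lambda>w. \<psi> w $ 1 - \<alpha> * \<psi> w $ 3 = 1) (nhds z)"
    by eventually_elim (use s_\<psi> in \<open>simp add: s_def\<close>)
  then have "((\<lambda>w. \<psi> w $ 1 - \<alpha> * \<psi> w $ 3) has_field_derivative 0) (at z)"
    by (subst DERIV_cong_ev[where g = "\<lambda>_. 1"]) auto
  moreover have "((\<lambda>w. \<psi> w $ 1 - \<alpha> * \<psi> w $ 3) has_field_derivative d 1 - \<alpha> * d 3) (at z)"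
    by (intro DERIV_diff DERIV_cmult d)
  ultimately have d1: "d 1 = \<alpha> * d 3" by (auto dest: DERIV_unique)
  have "((\<lambda>w. t (\<psi> w)) has_field_derivative d 2 - \<beta> * d 3) (at z)"
    unfolding t_def by (intro DERIV_diff DERIV_cmult d)
  then have d2: "d 2 - \<beta> * d 3 \<noteq> 0" using z(2) DERIV_imp_deriv by force
  have "((\<lambda>w. F (\<psi> w)) has_field_derivative (\<Sum>i\<in>UNIV. g i * d i)) (at z)"
    unfolding g_def by (rule partials_DERIV[OF G d])
  then have tangent: "(\<Sum>i\<in>UNIV. g i * d i) = 0"
    unfolding F_\<psi> using DERIV_unique[OF _ DERIV_const] by blast
  have euler: "(\<Sum>i\<in>UNIV. g i * \<psi> z $ i) = 0"
    using form3_euler[OF form3_F G, of "\<psi> z"] F_\<psi> by (simp add: g_def)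
  have H: "g 1 * \<alpha> + g 2 * \<beta> + g 3 = 0"
    using z(3) by (simp add: sum_3 g_def)
  \<comment> \<open>Subtracting the center from the tangent vector \<open>d 3\<close> times leaves
    only a second component, the derivative of \<open>t\<close> along the chart, which is
    nonzero.\<close>
  have "g 2 * (d 2 - \<beta> * d 3) = (g 1 * d 1 + g 2 * d 2 + g 3 * d 3) - d 3 * (g 1 * \<alpha> + g 2 * \<beta> + g 3)"
    using d1 by (simp add: algebra_simps)
  also have "\<dots> = 0" using tangent H by (simp add: sum_3)
  finally have g2: "g 2 = 0" using d2 by simp
  have "\<psi> z $ 1 = 1 + \<alpha> * \<psi> z $ 3" using s_\<psi>[OF z(1)] by (simp add: s_def algebra_simps)
  \<comment> \<open>The same elimination with the position vector: its first component becomes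
    \<open>s = 1\<close>, and the second no longer counts since \<open>g 2 = 0\<close>.\<close>
  then have "g 1 = (g 1 * \<psi> z $ 1 + g 2 * \<psi> z $ 2 + g 3 * \<psi> z $ 3) - \<psi> z $ 3 * (g 1 * \<alpha> + g 2 * \<beta> + g 3)"
    using g2 by (simp add: algebra_simps)
  also have "\<dots> = 0" using euler H by (simp add: sum_3)
  finally have g1: "g 1 = 0" .
  have "g i = 0" for i using g1 g2 H exhaust_3[of i] by auto
  moreover have "\<psi> z \<noteq> 0" using s_\<psi>[OF z(1)] by (auto simp: s_def)
  ultimately have "proj_pt (\<psi> z) \<in> singular_points F"
    by (intro singular_pointI[OF G]) (auto simp: F_\<psi> g_def)
  moreover have "proj_pt (\<psi> z) = \<pi> (torus_pt lattice z)"
    unfolding \<psi>_def rep(2) using z(1) by (intro proj_pt_scale) simp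
  ultimately show False using z(4) nodes(1) by simp
qed

lemma \<psi>_eq_pencil:
  assumes "s (rep z) \<noteq> 0"
  shows "\<psi> z = pencil (t (\<psi> z)) (\<psi> z $ 3)"
  using s_\<psi>[OF assms] by (simp add: vec_eq_iff forall_3 pencil_nth s_def t_def algebra_simps)

lemma curve_point_pencil:
  assumes "F (pencil \<mu> u) = 0"
  shows "\<exists>z\<in>parallelogram 0. s (rep z) \<noteq> 0 \<and> \<psi> z = pencil \<mu> u"
proof -
  obtain z k where z: "z \<in> parallelogram 0" "k \<noteq> 0" "rep z = k *s pencil \<mu> u"
    using curve_point[OF pencil_nonzero assms] by blast
  then have "s (rep z) = k" by (simp add: form3_scale[OF form3_s] s_pencil)
  moreover have "\<psi> z = pencil \<mu> u"
    unfolding \<psi>_def z(3) using z(2) by (simp add: form3_scale[OF form3_s] s_pencil)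
  ultimately show ?thesis using z by blast
qed

text \<open>Points where the line through the center is tangent to the curve, where
  \<open>t / s\<close> ramifies, or which lie over a node are sparse, so a period parallelogram has
  finitely many. Avoiding their slopes makes all four intersections simple.\<close>

lemma generic_line:
  "\<exists>B. finite B \<and> (\<forall>\<mu>. \<mu> \<notin> B \<longrightarrow> card {u. F (pencil \<mu> u) = 0} = 4 \<and>
     (\<forall>z\<in>parallelogram 0. s (rep z) \<noteq> 0 \<and> t (\<psi> z) = \<mu> \<longrightarrow>
        deriv (\<lambda>w. t (\<psi> w)) z \<noteq> 0 \<and> \<pi> (torus_pt lattice z) \<notin> {T1, T2}))"
proof -
  obtain G where G: "partials F G" using ex_partials[OF form3_poly3[OF form3_F]] by blast
  define good where "good z \<longleftrightarrow> (\<Sum>i\<in>UNIV. G i (\<psi> z) * center $ i) \<noteq> 0 \<and>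
    deriv (\<lambda>w. t (\<psi> w)) z \<noteq> 0 \<and> \<pi> (torus_pt lattice z) \<notin> {T1, T2}" for z
  have "eventually (\<lambda>z. \<pi> (torus_pt lattice z) \<notin> {T1, T2}) (cosparse UNIV)"
    using eventually_ne_point[of T1] eventually_ne_point[of T2] nodes(2) by (auto elim: eventually_elim2)
  then have "eventually good (cosparse UNIV)"
    using eventually_transversal[OF G] eventually_deriv_nonzero by eventually_elim (simp add: good_def)
  then have fin: "finite {z \<in> parallelogram 0. \<not> good z}"
    by (rule finite_zeros_bounded[OF _ bounded_parallelogram])
  define B where "B = (\<lambda>z. t (\<psi> z)) ` {z \<in> parallelogram 0. \<not> good z}"
  have "card {u. F (pencil \<mu> u) = 0} = 4 \<and>
     (\<forall>z\<in>parallelogram 0. s (rep z) \<noteq> 0 \<and> t (\<psi> z) = \<mu> \<longrightarrow>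
        deriv (\<lambda>w. t (\<psi> w)) z \<noteq> 0 \<and> \<pi> (torus_pt lattice z) \<notin> {T1, T2})" if "\<mu> \<notin> B" for \<mu>
  proof
    have good: "good z" if "z \<in> parallelogram 0" "t (\<psi> z) = \<mu>" for z
      using that \<open>\<mu> \<notin> B\<close> by (auto simp: B_def)
    then show "\<forall>z\<in>parallelogram 0. s (rep z) \<noteq> 0 \<and> t (\<psi> z) = \<mu> \<longrightarrow>
        deriv (\<lambda>w. t (\<psi> w)) z \<noteq> 0 \<and> \<pi> (torus_pt lattice z) \<notin> {T1, T2}"
      by (auto simp: good_def)
    obtain p where p: "degree p = 4" "\<And>u. poly p u = F (pencil \<mu> u)" using line_poly by blast
    \<comment> \<open>A root is a curve point, and the derivative of \<open>p\<close> there is that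
      of \<open>F\<close> along the center, the direction of the line.\<close>
    have "poly (pderiv p) u \<noteq> 0" if "poly p u = 0" for u
    proof -
      have "F (pencil \<mu> u) = 0" using that p(2) by simp
      then obtain z where z: "z \<in> parallelogram 0" "\<psi> z = pencil \<mu> u" using curve_point_pencil by blast
      then have "(\<Sum>i\<in>UNIV. G i (pencil \<mu> u) * center $ i) \<noteq> 0"
        using good[OF z(1)] by (simp add: good_def t_pencil)
      moreover have "((\<lambda>u. F (pencil \<mu> u)) has_field_derivative (\<Sum>i\<in>UNIV. G i (pencil \<mu> u) * center $ i)) (at u)"
        by (rule partials_DERIV[OF G]) (auto simp: pencil_def intro!: derivative_eq_intros)
      then have "(poly p has_field_derivative (\<Sum>i\<in>UNIV. G i (pencil \<mu> u) * center $ i)) (at u)"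
        unfolding p(2)[symmetric] .
      ultimately show ?thesis using DERIV_unique[OF poly_DERIV] by metis
    qed
    then have "rsquarefree p" by (auto simp: rsquarefree_roots)
    moreover have "p \<noteq> 0" using p(1) by auto
    ultimately have "card {u. poly p u = 0} = 4"
      using card_roots_rsquarefree[of p] p(1) by simp
    then show "card {u. F (pencil \<mu> u) = 0} = 4" by (simp add: p(2))
  qed
  moreover have "finite B" unfolding B_def using fin by (rule finite_imageI)
  ultimately show ?thesis by blast
qed


text \<open>All linear forms have the same total order, so \<open>s\<close> may be exchanged for
  \<open>t - \<mu> * s\<close> with a generic slope. Its zeros are simple and correspond to the four
  roots of the quartic on that line.\<close>

lemma sum_s_order: "(\<Sum>z\<in>zero_set s. s_order z) = 4"
proof -
  obtain B where "finite B" and B: "\<And>\<mu>. \<mu> \<notin> B \<Longrightarrow> card {u. F (pencil \<mu> u) = 0} = 4 \<and>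
     (\<forall>z\<in>parallelogram 0. s (rep z) \<noteq> 0 \<and> t (\<psi> z) = \<mu> \<longrightarrow>
        deriv (\<lambda>w. t (\<psi> w)) z \<noteq> 0 \<and> \<pi> (torus_pt lattice z) \<notin> {T1, T2})"
    using generic_line by blast
  obtain \<mu> where \<mu>: "\<mu> \<notin> B"
    using ex_new_if_finite[OF infinite_UNIV_char_0 \<open>finite B\<close>] by blast
  note generic = B[OF \<mu>]
  define c where "c v = (- \<mu>) * s v + 1 * t v" for v
  have c: "form3 1 c" unfolding c_def[abs_def] by (rule form3_st)
  have nv: "nonvanishing c"
    using eventually_avoid[of \<mu>] by (auto simp: c_def elim: eventually_mono)
  \<comment> \<open>A zero of \<open>c\<close> with \<open>s = 0\<close> would also have
    \<open>t = 0\<close> and thus be the center.\<close>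
  have Z: "zero_set c = {z \<in> parallelogram 0. s (rep z) \<noteq> 0 \<and> t (\<psi> z) = \<mu>}"
    using center_avoid by (auto simp: zero_set_def c_def t_\<psi> field_simps)
  have ord: "form_order c 1 z = 1" if "z \<in> zero_set c" for z
  proof -
    have z: "s (rep z) \<noteq> 0" "t (\<psi> z) = \<mu>" "deriv (\<lambda>w. t (\<psi> w)) z \<noteq> 0"
      using that generic unfolding Z by auto
    have "eventually (\<lambda>w. s (rep w) \<noteq> 0) (nhds z)"
      using z(1) nonvanishing_at[OF eventually_s, of z] by (simp add: eventually_nhds_conv_at)
    then have "eventually (\<lambda>w. c (\<psi> w) = t (\<psi> w) - \<mu>) (nhds z)"
      by eventually_elim (simp add: c_def s_\<psi>)
    then have "deriv (\<lambda>w. c (\<psi> w)) z = deriv (\<lambda>w. t (\<psi> w) - \<mu>) z"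
      by (intro deriv_cong_ev) auto
    also have "\<dots> = deriv (\<lambda>w. t (\<psi> w)) z"
      using poly3_\<psi>_analytic[OF form3_poly3[OF form3_t] z(1)] analytic_on_imp_differentiable_at
      by (subst deriv_diff) auto
    finally have "deriv (\<lambda>w. c (\<psi> w)) z \<noteq> 0" using z(3) by simp
    moreover have "c (\<psi> z) = 0" using z(1,2) by (simp add: c_def s_\<psi>)
    ultimately have "zorder (\<lambda>w. c (\<psi> w)) z = 1"
      by (intro zorder_zero_eqI' poly3_\<psi>_analytic form3_poly3[OF c] z(1)) auto
    then show ?thesis using s_order_nonneg(3)[of z] z(1) by (simp add: form_order_def)
  qed
  have "bij_betw (\<lambda>z. \<psi> z $ 3) (zero_set c) {u. F (pencil \<mu> u) = 0}"
    unfolding bij_betw_def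
  proof
    have pencil: "\<psi> z = pencil \<mu> (\<psi> z $ 3)" if "z \<in> zero_set c" for z
      using \<psi>_eq_pencil[of z] that by (simp add: Z)
    show "inj_on (\<lambda>z. \<psi> z $ 3) (zero_set c)"
    proof (rule inj_onI)
      fix z w assume zw: "z \<in> zero_set c" "w \<in> zero_set c" "\<psi> z $ 3 = \<psi> w $ 3"
      then have "\<psi> z = \<psi> w" using pencil by metis
      moreover have \<pi>_\<psi>: "\<pi> (torus_pt lattice x) = proj_pt (\<psi> x)" if "x \<in> zero_set c" for x
        using that proj_pt_scale[of "1 / s (rep x)" "rep x"] by (simp add: Z \<psi>_def rep(2))
      ultimately have "\<pi> (torus_pt lattice z) = \<pi> (torus_pt lattice w)" using zw by simp
      \<comment> \<open>The normalization is injective only away from the nodes, which the generic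
        line misses.\<close>
      moreover have "torus_pt lattice x \<in> {x \<in> carrier (torus lattice). \<pi> x \<notin> {T1, T2}}" if "x \<in> zero_set c" for x
        using that generic by (auto simp: Z carrier_torus)
      moreover have "inj_on \<pi> {x \<in> carrier (torus lattice). \<pi> x \<notin> {T1, T2}}"
        using normalization by (simp add: elliptic_normalization_def bij_betw_def)
      ultimately have "torus_pt lattice z = torus_pt lattice w"
        using zw by (meson inj_onD)
      then show "z = w"
        using zw parallelogram_inject by (auto simp: torus_pt_eq_iff Z)
    qed
    show "(\<lambda>z. \<psi> z $ 3) ` zero_set c = {u. F (pencil \<mu> u) = 0}"
    proof (intro equalityI subsetI)
      fix u assume "u \<in> (\<lambda>z. \<psi> z $ 3) ` zero_set c"
      then show "u \<in> {u. F (pencil \<mu> u) = 0}" using pencil F_\<psi> by force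
    next
      fix u assume "u \<in> {u. F (pencil \<mu> u) = 0}"
      then obtain z where "z \<in> parallelogram 0" "s (rep z) \<noteq> 0" "\<psi> z = pencil \<mu> u"
        using curve_point_pencil by blast
      then show "u \<in> (\<lambda>z. \<psi> z $ 3) ` zero_set c"
        by (intro image_eqI[of _ _ z]) (auto simp: Z t_pencil pencil_nth)
    qed
  qed
  then have "card (zero_set c) = 4"
    using generic by (simp add: bij_betw_same_card)
  then have "(\<Sum>z\<in>zero_set c. form_order c 1 z) = 4" by (subst sum.cong[OF refl ord]) simp_all
  then show ?thesis using form_order_sums(1)[OF c nv] by simp
qed

text \<open>A conic containing the curve would have four zeros on every generic line through the
  center, hence contain these lines. Polynomial identities then extend the vanishing to all slopes,
  to the cone where \<open>s\<close> is nonzero, and finally to the whole space.\<close>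

lemma conic_nonvanishing:
  assumes c: "ternary_form 2 c" and "c v \<noteq> 0"
  shows "nonvanishing c"
proof (rule ccontr)
  assume "\<not> nonvanishing c"
  note form = ternary_form_imp_form3[OF c]
  have c0: "c (rep z) = 0" for z using form_dichotomy[OF form] \<open>\<not> nonvanishing c\<close> by blast
  obtain B where "finite B" and B: "\<And>\<mu>. \<mu> \<notin> B \<Longrightarrow> card {u. F (pencil \<mu> u) = 0} = 4"
    using generic_line by blast
  have generic: "c (pencil \<mu> u) = 0" if "\<mu> \<notin> B" for \<mu> u
  proof -
    obtain p where p: "degree p \<le> 2" "\<And>u. poly p u = c (pencil \<mu> u)"
      using ternary_form_line[OF c, of center "vector [1, \<mu>, 0]"] unfolding pencil_def by blast
    have "p = 0"
    proof (rule ccontr)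
      assume "p \<noteq> 0"
      have "{u. F (pencil \<mu> u) = 0} \<subseteq> {u. poly p u = 0}"
      proof
        fix u assume "u \<in> {u. F (pencil \<mu> u) = 0}"
        then obtain z where "\<psi> z = pencil \<mu> u" using curve_point_pencil by blast
        then show "u \<in> {u. poly p u = 0}" using form_\<psi>[OF form, of z] c0[of z] by (simp add: p(2))
      qed
      then have "4 \<le> card {u. poly p u = 0}"
        using card_mono[OF poly_roots_finite[OF \<open>p \<noteq> 0\<close>]] B[OF that] by metis
      then show False using card_poly_roots_bound[OF \<open>p \<noteq> 0\<close>] p(1) by linarith
    qed
    then show ?thesis using p(2)[of u] by simp
  qed
  have all: "c (pencil \<mu> u) = 0" for \<mu> u
  proof -
    obtain p where p: "\<And>\<mu>. poly p \<mu> = c (pencil 0 u + \<mu> *s axis 2 1)"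
      using ternary_form_line[OF c, of "axis 2 1" "pencil 0 u"] by blast
    have eq: "pencil 0 u + \<mu> *s axis 2 1 = pencil \<mu> u" for \<mu>
      by (simp add: vec_eq_iff forall_3 pencil_nth axis_def)
    have "p = 0"
    proof (rule ccontr)
      assume "p \<noteq> 0"
      then have "finite (B \<union> {\<mu>. poly p \<mu> = 0})" using \<open>finite B\<close> by (simp add: poly_roots_finite)
      moreover have "B \<union> {\<mu>. poly p \<mu> = 0} = UNIV" using generic by (auto simp: p eq)
      ultimately show False using infinite_UNIV_char_0[where 'a = complex] by simp
    qed
    then show ?thesis using p[of \<mu>] by (simp add: eq)
  qed
  have chart: "c w = 0" if "s w \<noteq> 0" for w
  proof -
    have eq: "w = s w *s pencil (t w / s w) (w $ 3 / s w)"
      using that by (simp add: vec_eq_iff forall_3 pencil_nth field_simps) (simp add: s_def t_def algebra_simps)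
    show ?thesis by (subst eq) (simp only: form3_scale[OF form] all mult_zero_right)
  qed
  \<comment> \<open>In this direction \<open>s\<close> grows by exactly \<open>x\<close>, so the
    line through \<open>v\<close> leaves \<open>s = 0\<close> at all but one parameter.\<close>
  obtain p where p: "\<And>x. poly p x = c (v + x *s vector [1, 0, 0])"
    using ternary_form_line[OF c, of "vector [1, 0, 0]" v] by blast
  have "poly p x = 0" if "x \<noteq> - s v" for x
  proof -
    have "s (v + x *s vector [1, 0, 0]) = s v + x" by (simp add: s_def)
    then have "s (v + x *s vector [1, 0, 0]) \<noteq> 0" using that by (simp add: add_eq_0_iff)
    then show ?thesis unfolding p by (rule chart)
  qed
  then have "UNIV \<subseteq> insert (- s v) {x. poly p x = 0}" by blast
  then have "p = 0"
    using infinite_UNIV_char_0[where 'a = complex] poly_roots_finite[of p]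
    by (meson finite_insert finite_subset)
  then show False using p[of 0] \<open>c v \<noteq> 0\<close> by simp
qed

end


subsection \<open>Residual divisors of conics\<close>

lemma sum_mset_sum: "sum_mset (\<Sum>x\<in>A. f x) = (\<Sum>x\<in>A. sum_mset (f x))"
  by (induction A rule: infinite_finite_induct) auto

lemma count_image_mset_inj_on:
  assumes "inj_on f S" "set_mset A \<subseteq> S" "x \<in> S"
  shows "count (image_mset f A) (f x) = count A x"
  using assms(2)
proof (induction A)
  case (add a A)
  then have "f a = f x \<longleftrightarrow> a = x" using inj_on_eq_iff[OF assms(1)] assms(3) by simp
  then show ?case using add by simp
qed simp

lemma size_mset_3: "size M = 3 \<Longrightarrow> \<exists>x y z. M = {#x, y, z#}"
proof -
  assume "size M = 3"
  then obtain x A where A: "M = add_mset x A" "size A = Suc (Suc 0)"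
    using size_eq_Suc_imp_eq_union[of M "Suc (Suc 0)"] by auto
  then obtain y B where B: "A = add_mset y B" "size B = Suc 0"
    using size_eq_Suc_imp_eq_union[of A "Suc 0"] by auto
  then obtain z where "B = {#z#}" using size_eq_Suc_imp_eq_union[of B 0] by auto
  then show ?thesis using A B by blast
qed

section \<open>Divisors on the torus as multisets of complex numbers\<close>

context binodal_chart
begin

definition torus_rep :: "complex set \<Rightarrow> complex" where
  "torus_rep = inv_into (parallelogram 0) (torus_pt lattice)"

lemma bij_betw_torus_rep: "bij_betw torus_rep (carrier (torus lattice)) (parallelogram 0)"
  unfolding torus_rep_def by (rule bij_betw_inv_into[OF bij_betw_torus_pt])

lemma torus_pt_rep: "x \<in> carrier (torus lattice) \<Longrightarrow> torus_pt lattice (torus_rep x) = x"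
  unfolding torus_rep_def by (rule bij_betw_inv_into_right[OF bij_betw_torus_pt])

lemma torus_rep_pt: "z \<in> parallelogram 0 \<Longrightarrow> torus_rep (torus_pt lattice z) = z"
  unfolding torus_rep_def by (rule bij_betw_inv_into_left[OF bij_betw_torus_pt])

lemma torus_rep_in: "x \<in> carrier (torus lattice) \<Longrightarrow> torus_rep x \<in> parallelogram 0"
  using bij_betw_torus_rep by (auto simp: bij_betw_def)

text \<open>The pullback divisor, which is effective and so can be a multiset. Its points are
  complex representatives, so that they can be added before passing to the torus.\<close>

definition zero_mset :: "(complex ^ 3 \<Rightarrow> complex) \<Rightarrow> nat \<Rightarrow> complex multiset" where
  "zero_mset c d = (\<Sum>z\<in>zero_set c. replicate_mset (nat (form_order c d z)) z)"

lemma count_zero_mset: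
  assumes "form3 d c" "nonvanishing c"
  shows "count (zero_mset c d) z = (if z \<in> parallelogram 0 then nat (form_order c d z) else 0)"
proof -
  have "count (zero_mset c d) z = (\<Sum>w\<in>zero_set c. if z = w then nat (form_order c d w) else 0)"
    by (auto simp: zero_mset_def count_sum intro!: sum.cong)
  also have "\<dots> = (if z \<in> zero_set c then nat (form_order c d z) else 0)"
    using finite_zero_set[OF assms(2)] by simp
  finally show ?thesis
    using form_order_nonneg(3)[OF assms, of z] by (auto simp: zero_set_def)
qed

text \<open>The Bezout number of the quartic and a curve of degree \<open>d\<close>, with the factor
  4 from the zeros of a linear form.\<close>

lemma size_zero_mset:
  assumes "form3 d c" "nonvanishing c"
  shows "size (zero_mset c d) = 4 * d"
proof -
  have "int (size (zero_mset c d)) = (\<Sum>z\<in>zero_set c. form_order c d z)"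
    using form_order_nonneg(1)[OF assms] by (simp add: zero_mset_def size_multiset_sum)
  also have "\<dots> = 4 * int d" using form_order_sums(1)[OF assms] by (simp add: sum_s_order)
  finally show ?thesis by simp
qed

lemma sum_zero_mset:
  assumes "form3 d c" "nonvanishing c"
  shows "sum_mset (zero_mset c d) - of_nat d * (\<Sum>z\<in>zero_set s. of_int (s_order z) * z) \<in> lattice"
proof -
  have "sum_mset (zero_mset c d) = (\<Sum>z\<in>zero_set c. of_int (form_order c d z) * z)"
    unfolding zero_mset_def sum_mset_sum
    using form_order_nonneg(1)[OF assms] by (intro sum.cong) (simp_all add: sum_mset_replicate_mset)
  then show ?thesis using form_order_sums(2)[OF assms] by simp
qed

text \<open>Turns the pointwise condition in \<open>additional_points\<close> into one equality of
  multisets, from which size, difference and sum are read off.\<close>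

lemma pullback_order_count:
  assumes "form3 d c" "nonvanishing c" and A: "set_mset A \<subseteq> carrier (torus lattice)"
  shows "(\<forall>x\<in>carrier (torus lattice). pullback_order lattice \<pi> c x = int (count A x)) \<longleftrightarrow>
    zero_mset c d = image_mset torus_rep A"
proof -
  have inj: "inj_on torus_rep (carrier (torus lattice))"
    using bij_betw_torus_rep by (simp add: bij_betw_def)
  have count: "count (image_mset torus_rep A) z = (if z \<in> parallelogram 0 then count A (torus_pt lattice z) else 0)" for z
  proof (cases "z \<in> parallelogram 0")
    case True
    have "torus_pt lattice z \<in> carrier (torus lattice)" by (simp add: carrier_torus)
    then show ?thesis
      using count_image_mset_inj_on[OF inj A, of "torus_pt lattice z"] True by (simp add: torus_rep_pt)
  next
    case False
    then have "z \<notin># image_mset torus_rep A" using A torus_rep_in by auto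
    then show ?thesis using False by (metis count_eq_zero_iff)
  qed
  have conv: "form_order c d z = int m \<longleftrightarrow> nat (form_order c d z) = m" for z m
    using form_order_nonneg(1)[OF assms(1,2), of z] by auto
  have "(\<forall>x\<in>carrier (torus lattice). pullback_order lattice \<pi> c x = int (count A x)) \<longleftrightarrow>
      (\<forall>z\<in>parallelogram 0. form_order c d z = int (count A (torus_pt lattice z)))"
    unfolding bij_betw_imp_surj_on[OF bij_betw_torus_pt[of 0], symmetric]
    by (simp add: pullback_order_eq[OF assms(1,2)])
  also have "\<dots> \<longleftrightarrow> (\<forall>z. count (zero_mset c d) z = count (image_mset torus_rep A) z)"
    by (auto simp: count_zero_mset[OF assms(1,2)] count conv)
  finally show ?thesis by (simp add: multiset_eq_iff)
qed

text \<open>Two points over each node and a single one over \<open>P\<close>, where the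
  normalization is injective.\<close>

lemma card_base_points:
  assumes P: "P \<in> plane_curve F - {T1, T2}"
  shows "finite {y \<in> carrier (torus lattice). \<pi> y \<in> {T1, T2, P}}"
    and "card {y \<in> carrier (torus lattice). \<pi> y \<in> {T1, T2, P}} = 5"
proof -
  define f where "f T = {y \<in> carrier (torus lattice). \<pi> y = T}" for T
  have T: "card (f T1) = 2" "card (f T2) = 2"
    using normalization by (auto simp: elliptic_normalization_def f_def)
  have fin: "finite (f T1)" "finite (f T2)" using T by (metis card.infinite zero_neq_numeral)+
  have bij: "bij_betw \<pi> {x \<in> carrier (torus lattice). \<pi> x \<notin> {T1, T2}} (plane_curve F - {T1, T2})"
    using normalization by (simp add: elliptic_normalization_def)
  have "P \<in> \<pi> ` {x \<in> carrier (torus lattice). \<pi> x \<notin> {T1, T2}}"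
    unfolding bij_betw_imp_surj_on[OF bij] by (rule P)
  then obtain x where x: "x \<in> carrier (torus lattice)" "\<pi> x = P" by blast
  have fP: "f P = {x}"
    using x P inj_onD[OF bij_betw_imp_inj_on[OF bij]] by (auto simp: f_def)
  have "T1 \<noteq> T2" using quartic by (simp add: nondegenerate_binodal_quartic_def)
  have eq: "{y \<in> carrier (torus lattice). \<pi> y \<in> {T1, T2, P}} = (f T1 \<union> f T2) \<union> f P"
    by (auto simp: f_def)
  show "finite {y \<in> carrier (torus lattice). \<pi> y \<in> {T1, T2, P}}"
    unfolding eq using fin fP by simp
  have "card ((f T1 \<union> f T2) \<union> f P) = card (f T1 \<union> f T2) + card (f P)"
    using fin fP P by (intro card_Un_disjoint) (auto simp: f_def)
  also have "card (f T1 \<union> f T2) = card (f T1) + card (f T2)"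
    using fin \<open>T1 \<noteq> T2\<close> by (intro card_Un_disjoint) (auto simp: f_def)
  finally show "card {y \<in> carrier (torus lattice). \<pi> y \<in> {T1, T2, P}} = 5"
    unfolding eq using T fP by simp
qed

lemma conicD:
  assumes "c \<in> conics_through S"
  shows "form3 2 c" "nonvanishing c" "\<And>z. \<pi> (torus_pt lattice z) \<in> S \<Longrightarrow> c (rep z) = 0"
proof -
  obtain v where c: "ternary_form 2 c" "c v \<noteq> 0" "S \<subseteq> plane_curve c"
    using assms by (auto simp: conics_through_def)
  show "form3 2 c" "nonvanishing c"
    using ternary_form_imp_form3 conic_nonvanishing c by auto
  fix z assume "\<pi> (torus_pt lattice z) \<in> S"
  then have "proj_pt (rep z) \<in> plane_curve c" using c(3) rep(2) by auto
  then show "c (rep z) = 0" using plane_curve_proj_pt[OF \<open>form3 2 c\<close> _ rep(1)] by simp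
qed

text \<open>The conic passes through the base points, so each of the five preimages has multiplicity
  at least 1 in the divisor of degree 8. What remains has three elements.\<close>

lemma ex_additional_points:
  assumes P: "P \<in> plane_curve F - {T1, T2}" and c: "c \<in> conics_through {T1, T2, P}"
  shows "\<exists>X Y Z. additional_points lattice \<pi> {T1, T2, P} c X Y Z"
proof -
  define A where "A = {y \<in> carrier (torus lattice). \<pi> y \<in> {T1, T2, P}}"
  note A = card_base_points[OF P, folded A_def]
  note c' = conicD(1,2)[OF c]
  have inj: "inj_on torus_rep (carrier (torus lattice))"
    using bij_betw_torus_rep by (simp add: bij_betw_def)
  then have inj_A: "inj_on torus_rep A" by (rule inj_on_subset) (auto simp: A_def)
  have "mset_set (torus_rep ` A) \<subseteq># zero_mset c 2"
  proof (rule mset_subset_eqI)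
    fix z
    have "count (zero_mset c 2) z \<ge> 1" if "z \<in> torus_rep ` A"
    proof -
      obtain y where y: "y \<in> A" "z = torus_rep y" using \<open>z \<in> torus_rep ` A\<close> by blast
      then have "z \<in> parallelogram 0" "\<pi> (torus_pt lattice z) \<in> {T1, T2, P}"
        by (auto simp: A_def torus_rep_in torus_pt_rep)
      then show ?thesis
        using form_order_nonneg(2)[OF c', of z] conicD(3)[OF c, of z] by (simp add: count_zero_mset[OF c'])
    qed
    then show "count (mset_set (torus_rep ` A)) z \<le> count (zero_mset c 2) z"
      by (simp add: count_mset_set')
  qed
  then obtain R where R: "zero_mset c 2 = mset_set (torus_rep ` A) + R"
    by (rule mset_subset_eq_exists_conv[THEN iffD1, THEN exE])
  have "size R = 3"
    using arg_cong[OF R, of size] size_zero_mset[OF c'] A card_image[OF inj_A] by simp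
  then obtain x y z where xyz: "R = {#x, y, z#}" using size_mset_3 by blast
  have para: "w \<in> parallelogram 0" if "w \<in> {x, y, z}" for w
  proof -
    have "w \<in># zero_mset c 2" using that by (auto simp: R xyz)
    then show ?thesis by (auto simp: count_zero_mset[OF c'] simp flip: count_greater_zero_iff split: if_splits)
  qed
  define M where "M = mset_set A + {#torus_pt lattice x, torus_pt lattice y, torus_pt lattice z#}"
  have "set_mset M \<subseteq> carrier (torus lattice)"
    using A(1) by (auto simp: M_def A_def carrier_torus)
  moreover have "zero_mset c 2 = image_mset torus_rep M"
    using para by (simp add: R xyz M_def image_mset_mset_set[OF inj_A] torus_rep_pt)
  ultimately have "\<forall>w\<in>carrier (torus lattice). pullback_order lattice \<pi> c w = int (count M w)"
    using pullback_order_count[OF c'] by blast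
  then have "additional_points lattice \<pi> {T1, T2, P} c (torus_pt lattice x) (torus_pt lattice y) (torus_pt lattice z)"
    by (simp add: additional_points_def carrier_torus M_def A_def)
  then show ?thesis by blast
qed

lemma additional_points_sum:
  assumes P: "P \<in> plane_curve F - {T1, T2}" and c: "c \<in> conics_through {T1, T2, P}"
    and XYZ: "additional_points lattice \<pi> {T1, T2, P} c X Y Z"
  shows "torus_rep X + torus_rep Y + torus_rep Z +
      (\<Sum>y\<in>{y \<in> carrier (torus lattice). \<pi> y \<in> {T1, T2, P}}. torus_rep y)
      - 2 * (\<Sum>z\<in>zero_set s. of_int (s_order z) * z) \<in> lattice"
proof -
  define A where "A = {y \<in> carrier (torus lattice). \<pi> y \<in> {T1, T2, P}}"
  define M where "M = mset_set A + {#X, Y, Z#}"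
  note A = card_base_points[OF P, folded A_def]
  note c' = conicD(1,2)[OF c]
  have "set_mset M \<subseteq> carrier (torus lattice)"
    using A(1) XYZ by (auto simp: M_def A_def additional_points_def)
  moreover have "\<forall>w\<in>carrier (torus lattice). pullback_order lattice \<pi> c w = int (count M w)"
    using XYZ by (simp add: additional_points_def M_def A_def)
  ultimately have "zero_mset c 2 = image_mset torus_rep M"
    using pullback_order_count[OF c'] by blast
  then have "sum_mset (zero_mset c 2) = torus_rep X + torus_rep Y + torus_rep Z + (\<Sum>y\<in>A. torus_rep y)"
    by (simp add: M_def sum_unfold_sum_mset)
  then show ?thesis using sum_zero_mset[OF c'] by (simp add: A_def)
qed

text \<open>The condition on the neutral element is \<open>3 N = X + Y + Z\<close> in the original group law.\<close>

lemma ex_neutral_element: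
  assumes P: "P \<in> plane_curve F - {T1, T2}"
  shows "\<exists>N\<in>carrier (torus lattice). \<forall>c\<in>conics_through {T1, T2, P}.
           (\<exists>X Y Z. additional_points lattice \<pi> {T1, T2, P} c X Y Z) \<and>
           (\<forall>X Y Z. additional_points lattice \<pi> {T1, T2, P} c X Y Z \<longrightarrow>
              X \<otimes>\<^bsub>elliptic_group lattice N\<^esub> Y \<otimes>\<^bsub>elliptic_group lattice N\<^esub> Z = \<one>\<^bsub>elliptic_group lattice N\<^esub>)"
proof -
  define b where "b = (\<Sum>y\<in>{y \<in> carrier (torus lattice). \<pi> y \<in> {T1, T2, P}}. torus_rep y)"
  define k where "k = (\<Sum>z\<in>zero_set s. of_int (s_order z) * z)"
  \<comment> \<open>Modulo the lattice \<open>2 * k\<close> is the sum of the divisor of any of the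
    conics and \<open>b\<close> is the share of the five base points, so \<open>2 * k - b\<close> is
    the constant sum of the additional points.\<close>
  define \<nu> where "\<nu> = (2 * k - b) / 3"
  define N where "N = torus_pt lattice \<nu>"
  have "X \<otimes>\<^bsub>elliptic_group lattice N\<^esub> Y \<otimes>\<^bsub>elliptic_group lattice N\<^esub> Z = \<one>\<^bsub>elliptic_group lattice N\<^esub>"
    if c: "c \<in> conics_through {T1, T2, P}" and XYZ: "additional_points lattice \<pi> {T1, T2, P} c X Y Z"
    for c X Y Z
  proof -
    have car: "X \<in> carrier (torus lattice)" "Y \<in> carrier (torus lattice)" "Z \<in> carrier (torus lattice)"
      using XYZ by (auto simp: additional_points_def)
    define x y z where "x = torus_rep X" and "y = torus_rep Y" and "z = torus_rep Z"
    have eq: "X = torus_pt lattice x" "Y = torus_pt lattice y" "Z = torus_pt lattice z"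
      using car by (simp_all add: x_def y_def z_def torus_pt_rep)
    have "X \<otimes>\<^bsub>elliptic_group lattice N\<^esub> Y \<otimes>\<^bsub>elliptic_group lattice N\<^esub> Z
        = torus_pt lattice (x + y + - \<nu> + z + - \<nu>)"
      by (simp add: elliptic_group_def N_def eq torus_mult torus_inv)
    also have "\<dots> = torus_pt lattice \<nu>"
    proof -
      \<comment> \<open>Each of the two products in the shifted law subtracts \<open>\<nu>\<close>
        once; the comparison with the neutral element subtracts it a third time.\<close>
      have "x + y + - \<nu> + z + - \<nu> - \<nu> = x + y + z + b - 2 * k" by (simp add: \<nu>_def field_simps)
      then show ?thesis
        using additional_points_sum[OF P c XYZ, folded b_def k_def x_def y_def z_def]
        by (simp only: torus_pt_eq_iff)
    qed
    finally show ?thesis by (simp add: elliptic_group_def N_def)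
  qed
  moreover have "N \<in> carrier (torus lattice)" by (simp add: N_def carrier_torus)
  ultimately show ?thesis
    by (intro bexI[of _ N] ballI conjI allI impI ex_additional_points[OF P])
qed

end

text \<open>On the line through \<open>v\<close> in the third direction \<open>F\<close> is a
  nonzero polynomial, so some point has both \<open>F\<close> and the third coordinate nonzero. It
  is then scaled to third coordinate 1.\<close>

lemma ex_point_off_curve:
  assumes F: "ternary_form d F" and "F v \<noteq> 0"
  shows "\<exists>\<alpha> \<beta>. F (vector [\<alpha>, \<beta>, 1]) \<noteq> 0"
proof -
  obtain p where p: "\<forall>x. poly p x = F (v + x *s vector [0, 0, 1])"
    using ternary_form_line[OF F, of "vector [0, 0, 1]" v] by blast
  have "p \<noteq> 0" using p[rule_format, of 0] assms(2) by auto
  then have "finite (insert (- v $ 3) {x. poly p x = 0})" by (simp add: poly_roots_finite)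
  then obtain x where x: "x \<noteq> - v $ 3" "poly p x \<noteq> 0"
    using ex_new_if_finite[OF infinite_UNIV_char_0] by blast
  define w where "w = v + x *s vector [0, 0, 1]"
  have w: "w $ 3 \<noteq> 0" "F w \<noteq> 0"
    using x p by (auto simp: w_def add_eq_0_iff)
  have "w $ 3 *s vector [w $ 1 / w $ 3, w $ 2 / w $ 3, 1] = w"
    using w(1) by (simp add: vec_eq_iff forall_3)
  then have "F (vector [w $ 1 / w $ 3, w $ 2 / w $ 3, 1]) \<noteq> 0"
    using w(2) form3_zero_scale[OF ternary_form_imp_form3[OF F] w(1), of "vector [w $ 1 / w $ 3, w $ 2 / w $ 3, 1]"]
    by simp
  then show ?thesis by blast
qed

theorem theorem1p1:
  fixes F :: "complex ^ 3 \<Rightarrow> complex"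
    and T1 T2 P :: "(complex ^ 3) set"
    and \<Lambda> :: "complex set"
    and \<pi> :: "complex set \<Rightarrow> (complex ^ 3) set"
  assumes "nondegenerate_binodal_quartic F T1 T2"
    and "elliptic_normalization \<Lambda> \<pi> F T1 T2"
    and "P \<in> plane_curve F - {T1, T2}"
  shows "\<exists>N\<in>carrier (torus \<Lambda>). \<forall>c\<in>conics_through {T1, T2, P}.
           (\<exists>X Y Z. additional_points \<Lambda> \<pi> {T1, T2, P} c X Y Z) \<and>
           (\<forall>X Y Z. additional_points \<Lambda> \<pi> {T1, T2, P} c X Y Z \<longrightarrow>
              X \<otimes>\<^bsub>elliptic_group \<Lambda> N\<^esub> Y \<otimes>\<^bsub>elliptic_group \<Lambda> N\<^esub> Z = \<one>\<^bsub>elliptic_group \<Lambda> N\<^esub>)"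
proof -
  obtain \<omega>1 \<omega>2 where \<omega>: "Im (\<omega>2 / \<omega>1) \<noteq> 0"
    and \<Lambda>: "\<Lambda> = {of_int m * \<omega>1 + of_int n * \<omega>2 | m n. True}"
    using assms(2) unfolding elliptic_normalization_def complex_lattice_def by blast
  interpret period_lattice \<omega>1 \<omega>2 by unfold_locales (rule \<omega>)
  have L: "\<Lambda> = lattice" unfolding \<Lambda> lattice_def ..
  obtain v where "ternary_form 4 F" "F v \<noteq> 0"
    using assms(1) unfolding nondegenerate_binodal_quartic_def by blast
  then obtain \<alpha> \<beta> where "F (vector [\<alpha>, \<beta>, 1]) \<noteq> 0"
    using ex_point_off_curve by blast
  then interpret binodal_chart \<omega>1 \<omega>2 F T1 T2 \<pi> \<alpha> \<beta>
    using assms(1,2) L by unfold_locales simp_all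
  show ?thesis unfolding L by (rule ex_neutral_element[OF assms(3)])
qed

end
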